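(* Fix a type $\Delta$ and let $\mathcal Q$ be a finite maximal antichain in the homomorphism order $\mathcal C(\Delta)$. Let $D^*$ be the sum of all $\Delta$-trees (up to isomorphism) with at most one edge of each kind. Suppose that every element $Q\in\mathcal Q$ has the property that whenever $Y$ is a $\Delta$-structure with $Y<Q$ and $Y\to D^*$, there exists a $\Delta$-structure $X$ such that $Y<X<Q$ and $X\not\to D^*$. Then the antichain $\mathcal Q$ splits; moreover, the pair $(\mathcal F,\mathcal D)$ obtained from $\mathcal Q$ by the greedy partition (defined in the context, for any enumeration of $\mathcal Q$) is a splitting of $\mathcal Q$.
   Context: A type is a finite family $\Delta=(\delta_i:i\in I)$ of integers $\delta_i\ge 2$. A $\Delta$-structure $A$ consists of a finite non-empty base set $\underline{A}$ and relations $R_i(A)\subseteq\underline{A}^{\delta_i}$ ($i\in I$), whose elements are called edges of kind $i$. A homomorphism $A\to B$ is a map of base sets sending each edge of kind $i$ to an edge of kind $i$; write $A\to B$ if one exists. $A<B$ means $A\to B$ and $B\not\to A$. The homomorphism order $\mathcal C(\Delta)$ is the set of isomorphism classes of core $\Delta$-structures (structures not homomorphic to a proper induced substructure of themselves) partially ordered by $\to$; every structure is homomorphically equivalent to a unique core and is identified with it. The sum of structures is their disjoint union. The shadow of $A$ is the undirected multigraph on $\underline{A}$ with one edge $\{a_j,a_{j+1}\}$ for each edge $(a_1,\dots,a_{\delta_i})$ of $A$ and each $1\le j<\delta_i$; $A$ is a $\Delta$-tree if its shadow is a tree (multiple edges and loops count as cycles). An antichain is a set of pairwise incomparable elements; it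 is maximal if not properly contained in another antichain. A maximal antichain $\mathcal Q$ splits if it can be partitioned into disjoint sets $\mathcal Q_1,\mathcal Q_2$ such that every $\Delta$-structure $A$ satisfies $Q\to A$ for some $Q\in\mathcal Q_1$ or $A\to Q$ for some $Q\in\mathcal Q_2$; then $(\mathcal Q_1,\mathcal Q_2)$ is called a splitting of $\mathcal Q$. Greedy partition: let $\mathcal Q=\{Q_1,\dots,Q_n\}$ be enumerated, $\mathcal F_0=\emptyset$. For $i=1,\dots,n$: if there is a $\Delta$-structure $X$ with (i) $Q_i<X$, (ii) $F\not\to X$ for every $F\in\mathcal F_{i-1}$, (iii) $Q_j\not\to X$ for every $j>i$, let $\mathcal F_i=\mathcal F_{i-1}\cup\{Q_i\}$; otherwise $\mathcal F_i=\mathcal F_{i-1}$. Put $\mathcal F=\mathcal F_n$ and $\mathcal D=\mathcal Q\setminus\mathcal F$. *)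

theory Defs
  imports Main
begin

section \<open>Relational structures and homomorphisms\<close>

text \<open>
  A type is a family \<open>(\<delta> i)\<close> indexed by a finite set \<open>I\<close>. Edges of kind \<open>i\<close> are lists of length
  \<open>\<delta> i\<close>; relations at indices outside \<open>I\<close> are required to be empty, so that homomorphisms and
  isomorphisms need not mention \<open>I\<close>.
\<close>

definition is_type :: "'i set \<Rightarrow> ('i \<Rightarrow> nat) \<Rightarrow> bool" where
  "is_type I \<delta> \<longleftrightarrow> finite I \<and> (\<forall>i\<in>I. \<delta> i \<ge> 2)"

record ('i, 'v) rel_struct =
  base :: "'v set"
  rel :: "'i \<Rightarrow> 'v list set"

definition is_struct :: "'i set \<Rightarrow> ('i \<Rightarrow> nat) \<Rightarrow> ('i, 'v) rel_struct \<Rightarrow> bool" where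
  "is_struct I \<delta> A \<longleftrightarrow>
     finite (base A) \<and> base A \<noteq> {} \<and>
     (\<forall>i\<in>I. rel A i \<subseteq> {xs. length xs = \<delta> i \<and> set xs \<subseteq> base A}) \<and>
     (\<forall>i. i \<notin> I \<longrightarrow> rel A i = {})"

definition is_hom :: "('v \<Rightarrow> 'w) \<Rightarrow> ('i, 'v) rel_struct \<Rightarrow> ('i, 'w) rel_struct \<Rightarrow> bool" where
  "is_hom f A B \<longleftrightarrow>
     (\<forall>v\<in>base A. f v \<in> base B) \<and> (\<forall>i. \<forall>xs\<in>rel A i. map f xs \<in> rel B i)"

definition hom_to :: "('i, 'v) rel_struct \<Rightarrow> ('i, 'w) rel_struct \<Rightarrow> bool" (infix "\<leadsto>" 50) where
  "A \<leadsto> B \<longleftrightarrow> (\<exists>f. is_hom f A B)"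

definition hom_less :: "('i, 'v) rel_struct \<Rightarrow> ('i, 'w) rel_struct \<Rightarrow> bool" (infix "\<prec>" 50) where
  "A \<prec> B \<longleftrightarrow> A \<leadsto> B \<and> \<not> B \<leadsto> A"

definition isomorphic :: "('i, 'v) rel_struct \<Rightarrow> ('i, 'w) rel_struct \<Rightarrow> bool" where
  "isomorphic A B \<longleftrightarrow>
     (\<exists>f. bij_betw f (base A) (base B) \<and> (\<forall>i. map f ` rel A i = rel B i))"

definition induced :: "('i, 'v) rel_struct \<Rightarrow> 'v set \<Rightarrow> ('i, 'v) rel_struct" where
  "induced A S = \<lparr>base = S, rel = (\<lambda>i. {xs \<in> rel A i. set xs \<subseteq> S})\<rparr>"

definition is_core :: "'i set \<Rightarrow> ('i \<Rightarrow> nat) \<Rightarrow> ('i, 'v) rel_struct \<Rightarrow> bool" where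
  "is_core I \<delta> A \<longleftrightarrow>
     is_struct I \<delta> A \<and> \<not> (\<exists>S. S \<noteq> {} \<and> S \<subset> base A \<and> A \<leadsto> induced A S)"

section \<open>The homomorphism order\<close>

text \<open>
  Every finite structure is isomorphic to one whose base set consists of natural numbers, so
  isomorphism classes are taken among structures on finite subsets of \<^typ>\<open>nat\<close>.
\<close>

definition iso_rel :: "('i, nat) rel_struct rel" where
  "iso_rel = {(A, B). isomorphic A B}"

definition iso_classes :: "('i, nat) rel_struct set \<Rightarrow> ('i, nat) rel_struct set set" where
  "iso_classes S = S // (iso_rel \<inter> S \<times> S)"

text \<open>An isomorphism class is identified with a structure in it; everything below is invariant
  under isomorphism, so the choice is immaterial.\<close>

definition rep :: "('i, nat) rel_struct set \<Rightarrow> ('i, nat) rel_struct" where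
  "rep c = (SOME A. A \<in> c)"

definition hom_order :: "'i set \<Rightarrow> ('i \<Rightarrow> nat) \<Rightarrow> ('i, nat) rel_struct set set" where
  "hom_order I \<delta> = iso_classes {A. is_core I \<delta> A}"

definition antichain :: "'i set \<Rightarrow> ('i \<Rightarrow> nat) \<Rightarrow> ('i, nat) rel_struct set set \<Rightarrow> bool" where
  "antichain I \<delta> \<Q> \<longleftrightarrow>
     \<Q> \<subseteq> hom_order I \<delta> \<and> (\<forall>p\<in>\<Q>. \<forall>q\<in>\<Q>. p \<noteq> q \<longrightarrow> \<not> rep p \<leadsto> rep q)"

definition maximal_antichain ::
    "'i set \<Rightarrow> ('i \<Rightarrow> nat) \<Rightarrow> ('i, nat) rel_struct set set \<Rightarrow> bool" where
  "maximal_antichain I \<delta> \<Q> \<longleftrightarrow>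
     antichain I \<delta> \<Q> \<and> \<not> (\<exists>\<Q>'. antichain I \<delta> \<Q>' \<and> \<Q> \<subset> \<Q>')"

definition splitting ::
    "'i set \<Rightarrow> ('i \<Rightarrow> nat) \<Rightarrow> ('i, nat) rel_struct set set \<Rightarrow>
     ('i, nat) rel_struct set set \<times> ('i, nat) rel_struct set set \<Rightarrow> bool" where
  "splitting I \<delta> \<Q> = (\<lambda>(\<Q>1, \<Q>2).
     \<Q>1 \<union> \<Q>2 = \<Q> \<and> \<Q>1 \<inter> \<Q>2 = {} \<and>
     (\<forall>A::('i, nat) rel_struct. is_struct I \<delta> A \<longrightarrow>
        (\<exists>q\<in>\<Q>1. rep q \<leadsto> A) \<or> (\<exists>q\<in>\<Q>2. A \<leadsto> rep q)))"

definition splits :: "'i set \<Rightarrow> ('i \<Rightarrow> nat) \<Rightarrow> ('i, nat) rel_struct set set \<Rightarrow> bool" where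
  "splits I \<delta> \<Q> \<longleftrightarrow> (\<exists>\<Q>1 \<Q>2. splitting I \<delta> \<Q> (\<Q>1, \<Q>2))"

section \<open>Trees and the structure \<open>D*\<close>\<close>

text \<open>In an undirected multigraph a loop is an edge whose set of endpoints is a singleton.\<close>

record ('v, 'e) multigraph =
  verts :: "'v set"
  edges :: "'e set"
  ends :: "'e \<Rightarrow> 'v set"

definition adjacent :: "('v, 'e) multigraph \<Rightarrow> ('v \<times> 'v) set" where
  "adjacent G = {(u, v). \<exists>e\<in>edges G. ends G e = {u, v}}"

definition connected_multigraph :: "('v, 'e) multigraph \<Rightarrow> bool" where
  "connected_multigraph G \<longleftrightarrow> (\<forall>u\<in>verts G. \<forall>v\<in>verts G. (u, v) \<in> (adjacent G)\<^sup>*)"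

text \<open>A cycle of length 1 is a loop, a cycle of length 2 is a pair of parallel edges.\<close>

definition is_cycle :: "('v, 'e) multigraph \<Rightarrow> 'v list \<Rightarrow> 'e list \<Rightarrow> bool" where
  "is_cycle G vs es \<longleftrightarrow>
     vs \<noteq> [] \<and> length es = length vs \<and> distinct vs \<and> distinct es \<and>
     set vs \<subseteq> verts G \<and> set es \<subseteq> edges G \<and>
     (\<forall>k<length vs. ends G (es ! k) = {vs ! k, vs ! (Suc k mod length vs)})"

definition is_tree :: "('v, 'e) multigraph \<Rightarrow> bool" where
  "is_tree G \<longleftrightarrow>
     verts G \<noteq> {} \<and> connected_multigraph G \<and> \<not> (\<exists>vs es. is_cycle G vs es)"

text \<open>The edge \<open>(i, xs, j)\<close> of the shadow joins the \<open>j\<close>-th and the next entry of the edge \<open>xs\<close> of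
  kind \<open>i\<close> (counting from 0).\<close>

definition shadow :: "('i, 'v) rel_struct \<Rightarrow> ('v, 'i \<times> 'v list \<times> nat) multigraph" where
  "shadow A =
     \<lparr>verts = base A,
      edges = {(i, xs, j). xs \<in> rel A i \<and> Suc j < length xs},
      ends = (\<lambda>(i, xs, j). {xs ! j, xs ! Suc j})\<rparr>"

definition is_struct_tree :: "'i set \<Rightarrow> ('i \<Rightarrow> nat) \<Rightarrow> ('i, 'v) rel_struct \<Rightarrow> bool" where
  "is_struct_tree I \<delta> A \<longleftrightarrow> is_struct I \<delta> A \<and> is_tree (shadow A)"

definition struct_sum :: "'k set \<Rightarrow> ('k \<Rightarrow> ('i, 'v) rel_struct) \<Rightarrow> ('i, 'k \<times> 'v) rel_struct" where
  "struct_sum K A =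
     \<lparr>base = (SIGMA k:K. base (A k)),
      rel = (\<lambda>i. \<Union>k\<in>K. map (Pair k) ` rel (A k) i)\<rparr>"

definition D_star ::
    "'i set \<Rightarrow> ('i \<Rightarrow> nat) \<Rightarrow> ('i, ('i, nat) rel_struct set \<times> nat) rel_struct" where
  "D_star I \<delta> =
     struct_sum (iso_classes {T. is_struct_tree I \<delta> T \<and> (\<forall>i\<in>I. card (rel T i) \<le> 1)}) rep"

section \<open>The greedy partition\<close>

text \<open>\<open>greedy I \<delta> \<F> qs\<close> processes the elements of \<open>qs\<close> in order, starting from the set \<open>\<F>\<close> of
  elements already selected; the tail of the list consists of the \<open>Q\<^sub>j\<close> with larger index.\<close>

fun greedy ::
    "'i set \<Rightarrow> ('i \<Rightarrow> nat) \<Rightarrow> ('i, nat) rel_struct set set \<Rightarrow>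
     ('i, nat) rel_struct set list \<Rightarrow> ('i, nat) rel_struct set set" where
  "greedy I \<delta> \<F> [] = \<F>"
| "greedy I \<delta> \<F> (q # qs) =
     greedy I \<delta>
       (if \<exists>X::('i, nat) rel_struct. is_struct I \<delta> X \<and> rep q \<prec> X \<and>
              (\<forall>f\<in>\<F>. \<not> rep f \<leadsto> X) \<and> (\<forall>p\<in>set qs. \<not> rep p \<leadsto> X)
        then insert q \<F> else \<F>)
       qs"

definition greedy_partition ::
    "'i set \<Rightarrow> ('i \<Rightarrow> nat) \<Rightarrow> ('i, nat) rel_struct set list \<Rightarrow>
     ('i, nat) rel_struct set set \<times> ('i, nat) rel_struct set set" where
  "greedy_partition I \<delta> qs = (greedy I \<delta> {} qs, set qs - greedy I \<delta> {} qs)"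

end

theory Submission
  imports Defs "HOL-Library.Ramsey"
begin

text \<open>
  The proof assigns integer heights to vertices. For a kind \<open>i\<close> and a position \<open>j\<close>, call a map
  \<open>h\<close> a height if it grows by 1 from entry \<open>j\<close> to entry \<open>Suc j\<close> of every edge of kind \<open>i\<close> and is
  constant along all other shadow edges. A structure is balanced if it has a height for every
  \<open>(i, j)\<close>, that is, if it maps to the Cayley structure of a free abelian group with one generator
  for each \<open>(i, j)\<close>. Balancedness is inherited downwards along homomorphisms, and on a connected
  structure heights are unique up to an additive constant. Three facts carry the argument.

  \<^item> Every member \<open>q\<close> of the greedy set \<open>\<F>\<close> is balanced (\<open>greedy_balanced\<close>). The structure
    \<open>X\<close> that put \<open>q\<close> into \<open>\<F>\<close> lies above no other member of \<open>\<F>\<close> and below no member of the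
    antichain. Ramsey's theorem yields \<open>X' \<leadsto> X\<close> that still maps to no member of the antichain, but
    all of whose small substructures are balanced (\<open>locally_balanced_cover\<close>). By maximality and
    the greedy choice some member of \<open>\<F>\<close> maps to \<open>X'\<close>; it can only be \<open>q\<close>, so \<open>q\<close> is balanced.

  \<^item> A balanced structure \<open>B\<close> that does not map to \<open>D*\<close> has two edges of the same kind in one
    component whose first entries differ in some height (\<open>balanced_not_to_D_star\<close>): otherwise
    identifying the vertices of a component that agree in all heights leaves one edge of each kind,
    and a structure with heights and one edge of each kind cannot contain a cycle.

  \<^item> Joining two such edges by a long zigzag of edges of their kind destroys balancedness, because
    the zigzag forces equal heights (\<open>zigzag_not_balanced\<close>), while every small structure mapping to
    the result already maps to \<open>B\<close>, since it misses some level of the zigzag (\<open>zigzag_small\<close>).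

  Now suppose that \<open>A\<close> is neither above a member of \<open>\<F>\<close> nor below a member of the rest \<open>\<D>\<close>. The
  greedy choice rules out that \<open>A\<close> is only above members of the antichain, so \<open>A \<prec> q\<close> for some
  \<open>q \<in> \<F>\<close>. The assumption about \<open>D*\<close> moves \<open>A\<close> up to some \<open>B \<prec> q\<close> that does not map to \<open>D*\<close>. As
  \<open>q\<close> is balanced, so is \<open>B\<close>; attach a zigzag to \<open>B\<close>. The result has no member of the antichain
  below it, maps to no member of \<open>\<D>\<close> because \<open>A\<close> does not, and to no member of \<open>\<F>\<close> because those
  are balanced. This contradicts maximality.
\<close>
no_notation lesspoll (infixl "\<prec>" 50)

section \<open>Homomorphisms, cores and comparability\<close>

lemma struct_edgeD:
  assumes "is_struct I \<delta> A" "xs \<in> rel A i"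
  shows "i \<in> I" "length xs = \<delta> i" "set xs \<subseteq> base A"
  using assms unfolding is_struct_def by blast+

lemma is_hom_comp:
  assumes "is_hom f A B" "is_hom g B C"
  shows "is_hom (g \<circ> f) A C"
  unfolding is_hom_def
proof (intro conjI allI ballI)
  fix i xs assume "xs \<in> rel A i"
  then have "map g (map f xs) \<in> rel C i"
    using assms unfolding is_hom_def by blast
  then show "map (g \<circ> f) xs \<in> rel C i" by simp
qed (use assms in \<open>auto simp: is_hom_def\<close>)

lemma hom_to_refl: "A \<leadsto> A"
  unfolding hom_to_def is_hom_def by (intro exI[of _ id]) simp

lemma hom_to_trans: "A \<leadsto> B \<Longrightarrow> B \<leadsto> C \<Longrightarrow> A \<leadsto> C"
  unfolding hom_to_def using is_hom_comp by blast

definition hom_image :: "('v \<Rightarrow> 'w) \<Rightarrow> ('i, 'v) rel_struct \<Rightarrow> ('i, 'w) rel_struct" where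
  "hom_image f A = \<lparr>base = f ` base A, rel = (\<lambda>i. map f ` rel A i)\<rparr>"

lemma hom_image_struct:
  assumes "is_struct I \<delta> A"
  shows "is_struct I \<delta> (hom_image f A)"
  unfolding is_struct_def
proof (intro conjI ballI allI impI)
  fix i assume "i \<in> I"
  show "rel (hom_image f A) i \<subseteq> {xs. length xs = \<delta> i \<and> set xs \<subseteq> base (hom_image f A)}"
    using struct_edgeD(2,3)[OF assms, of _ i] unfolding hom_image_def by fastforce
qed (use assms in \<open>auto simp: is_struct_def hom_image_def\<close>)

lemma hom_image_hom: "is_hom f A (hom_image f A)"
  unfolding is_hom_def hom_image_def by auto

lemma hom_image_inj_hom_back:
  assumes A: "is_struct I \<delta> A" and inj: "inj_on f (base A)"
  shows "hom_image f A \<leadsto> A"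
proof -
  have "map (inv_into (base A) f) (map f xs) = xs" if "xs \<in> rel A i" for i xs
    using struct_edgeD(3)[OF A that] inj
    by (auto simp: map_idI subset_iff)
  moreover have "inv_into (base A) f (f v) \<in> base A" if "v \<in> base A" for v
    using that by (simp add: inv_into_into)
  ultimately have "is_hom (inv_into (base A) f) (hom_image f A) A"
    unfolding is_hom_def hom_image_def by auto
  then show ?thesis unfolding hom_to_def by blast
qed

lemma nat_copy:
  fixes A :: "('i, 'v) rel_struct"
  assumes A: "is_struct I \<delta> A"
  obtains B :: "('i, nat) rel_struct" where "is_struct I \<delta> B" "A \<leadsto> B" "B \<leadsto> A"
proof -
  obtain f :: "'v \<Rightarrow> nat" where "inj_on f (base A)"
    using A finite_imp_inj_to_nat_seg unfolding is_struct_def by metis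
  with A show ?thesis
    using that[of "hom_image f A"] hom_image_struct hom_image_hom hom_image_inj_hom_back
    unfolding hom_to_def by blast
qed

lemma hom_image_if_bij:
  assumes "bij_betw f (base A) (base B)" "\<forall>i. map f ` rel A i = rel B i"
  shows "B = hom_image f A"
  using assms by (intro rel_struct.equality) (auto simp: hom_image_def bij_betw_def)

lemma isomorphic_refl: "isomorphic A A"
  unfolding isomorphic_def by (intro exI[of _ id]) simp

lemma isomorphic_homs:
  assumes "is_struct I \<delta> A" "isomorphic A B"
  shows "A \<leadsto> B" "B \<leadsto> A"
proof -
  obtain f where f: "bij_betw f (base A) (base B)" "B = hom_image f A"
    using assms(2) hom_image_if_bij unfolding isomorphic_def by blast
  show "A \<leadsto> B" using f hom_image_hom unfolding hom_to_def by blast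
  show "B \<leadsto> A" using f hom_image_inj_hom_back[OF assms(1)] by (auto simp: bij_betw_def)
qed

lemma rep_in_class:
  assumes "A \<in> S" "c = (iso_rel \<inter> S \<times> S) `` {A}"
  shows "rep c \<in> S" "isomorphic A (rep c)"
proof -
  have "A \<in> c" using assms isomorphic_refl by (auto simp: iso_rel_def)
  then have "rep c \<in> c" unfolding rep_def by (rule someI)
  then show "rep c \<in> S" "isomorphic A (rep c)" using assms by (auto simp: iso_rel_def)
qed

lemma rep_hom_order:
  fixes c :: "('i, nat) rel_struct set"
  assumes "c \<in> hom_order I \<delta>"
  shows "is_struct I \<delta> (rep c)"
proof -
  define S :: "('i, nat) rel_struct set" where "S = {A. is_core I \<delta> A}"
  obtain A where A: "A \<in> S" "c = (iso_rel \<inter> S \<times> S) `` {A}"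
    using assms unfolding hom_order_def iso_classes_def S_def[symmetric] by (rule quotientE)
  have "rep c \<in> S" by (rule rep_in_class(1)[OF A])
  then show ?thesis by (simp add: S_def is_core_def)
qed

lemma induced_hom: "S \<subseteq> base A \<Longrightarrow> induced A S \<leadsto> A"
  unfolding hom_to_def is_hom_def induced_def by (intro exI[of _ id]) auto

lemma induced_struct:
  assumes "is_struct I \<delta> A" "S \<subseteq> base A" "S \<noteq> {}"
  shows "is_struct I \<delta> (induced A S)"
  unfolding is_struct_def
proof (intro conjI ballI allI impI)
  show "finite (base (induced A S))"
    using assms finite_subset unfolding is_struct_def induced_def by fastforce
  fix i assume "i \<in> I"
  show "rel (induced A S) i \<subseteq> {xs. length xs = \<delta> i \<and> set xs \<subseteq> base (induced A S)}"
    using struct_edgeD[OF assms(1)] unfolding induced_def by auto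
qed (use assms in \<open>auto simp: is_struct_def induced_def\<close>)

lemma core_exists:
  fixes A :: "('i, 'v) rel_struct"
  assumes "is_struct I \<delta> A"
  obtains C :: "('i, 'v) rel_struct" where "is_core I \<delta> C" "A \<leadsto> C" "C \<leadsto> A"
proof -
  have "\<exists>C::('i, 'v) rel_struct. is_core I \<delta> C \<and> A \<leadsto> C \<and> C \<leadsto> A"
    using assms
  proof (induction "card (base A)" arbitrary: A rule: less_induct)
    case less
    show ?case
    proof (cases "is_core I \<delta> A")
      case True
      then show ?thesis using hom_to_refl by blast
    next
      case False
      then obtain S where S: "S \<noteq> {}" "S \<subset> base A" "A \<leadsto> induced A S"
        using less.prems unfolding is_core_def by blast
      have "is_struct I \<delta> (induced A S)"
        using induced_struct[OF less.prems] S by blast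
      moreover have "card (base (induced A S)) < card (base A)"
        using S less.prems by (simp add: induced_def is_struct_def psubset_card_mono)
      ultimately obtain C :: "('i, 'v) rel_struct" where "is_core I \<delta> C" "induced A S \<leadsto> C" "C \<leadsto> induced A S"
        using less.hyps by blast
      moreover have "induced A S \<leadsto> A" using induced_hom S(2) by blast
      ultimately show ?thesis using S(3) hom_to_trans by blast
    qed
  qed
  then show ?thesis using that by blast
qed

text \<open>Maximality is stated for cores; passing to the core of \<open>A\<close> and then to the representative of
  its class extends it to all structures.\<close>
lemma maximal_antichain_comparable:
  fixes A :: "('i, nat) rel_struct"
  assumes max: "maximal_antichain I \<delta> \<Q>" and A: "is_struct I \<delta> A"
  shows "\<exists>q\<in>\<Q>. rep q \<leadsto> A \<or> A \<leadsto> rep q"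
proof -
  obtain C :: "('i, nat) rel_struct" where C: "is_core I \<delta> C" "A \<leadsto> C" "C \<leadsto> A"
    using core_exists[OF A] by blast
  define S :: "('i, nat) rel_struct set" where "S = {A. is_core I \<delta> A}"
  define c where "c = (iso_rel \<inter> S \<times> S) `` {C}"
  have CS: "C \<in> S" using C by (simp add: S_def)
  then have c: "c \<in> hom_order I \<delta>"
    unfolding hom_order_def iso_classes_def c_def S_def[symmetric] by (rule quotientI)
  have iso: "isomorphic C (rep c)" using rep_in_class(2)[OF CS c_def] .
  have C': "is_struct I \<delta> C" using C(1) by (simp add: is_core_def)
  note isos = isomorphic_homs[OF C' iso]
  have rep: "A \<leadsto> rep c" "rep c \<leadsto> A"
    by (rule hom_to_trans[OF C(2) isos(1)], rule hom_to_trans[OF isos(2) C(3)])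
  have "\<exists>q\<in>\<Q>. rep q \<leadsto> rep c \<or> rep c \<leadsto> rep q"
  proof (rule ccontr)
    assume no: "\<not> ?thesis"
    then have "c \<notin> \<Q>" using hom_to_refl by blast
    moreover have "antichain I \<delta> (insert c \<Q>)"
      using max no c unfolding maximal_antichain_def antichain_def by blast
    ultimately show False using max unfolding maximal_antichain_def by blast
  qed
  then show ?thesis using hom_to_trans[OF rep(1)] hom_to_trans[OF _ rep(2)] by blast
qed

section \<open>The greedy partition\<close>

lemma greedy_bounds: "\<F> \<subseteq> greedy I \<delta> \<F> qs \<and> greedy I \<delta> \<F> qs \<subseteq> \<F> \<union> set qs"
proof (induction qs arbitrary: \<F>)
  case (Cons q qs)
  show ?case using Cons[of \<F>] Cons[of "insert q \<F>"] by auto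
qed simp

text \<open>When the last list element that maps to \<open>X\<close> is processed and nothing selected before maps to
  \<open>X\<close>, the structure \<open>X\<close> itself is a witness for selecting that element.\<close>
lemma greedy_below:
  fixes X :: "('i, nat) rel_struct"
  assumes "is_struct I \<delta> X" "\<forall>q\<in>set qs. \<not> X \<leadsto> rep q" "q \<in> \<F> \<union> set qs" "rep q \<leadsto> X"
  shows "\<exists>f\<in>greedy I \<delta> \<F> qs. rep f \<leadsto> X"
  using assms
proof (induction qs arbitrary: \<F> q)
  case Nil
  then show ?case by auto
next
  case (Cons p qs)
  let ?\<F> = "if \<exists>X::('i, nat) rel_struct. is_struct I \<delta> X \<and> rep p \<prec> X \<and>
    (\<forall>f\<in>\<F>. \<not> rep f \<leadsto> X) \<and> (\<forall>p\<in>set qs. \<not> rep p \<leadsto> X) then insert p \<F> else \<F>"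
  have sub: "\<F> \<subseteq> ?\<F>" by auto
  have "\<exists>r\<in>?\<F> \<union> set qs. rep r \<leadsto> X"
  proof (cases "\<exists>r\<in>\<F> \<union> set qs. rep r \<leadsto> X")
    case True
    then show ?thesis using sub by blast
  next
    case False
    then have "q = p" using Cons.prems by auto
    then have "rep p \<prec> X" using Cons.prems by (auto simp: hom_less_def)
    then have "?\<F> = insert p \<F>" using False Cons.prems(1) by (auto intro!: exI[of _ X])
    then show ?thesis using Cons.prems \<open>q = p\<close> by auto
  qed
  then obtain r where r: "r \<in> ?\<F> \<union> set qs" "rep r \<leadsto> X" by blast
  have "\<exists>f\<in>greedy I \<delta> ?\<F> qs. rep f \<leadsto> X"
    by (rule Cons.IH[OF Cons.prems(1) _ r]) (use Cons.prems(2) in simp)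
  then show ?case by (simp only: greedy.simps)
qed

text \<open>The witness for selecting \<open>q\<close> avoids everything selected before \<open>q\<close> as well as everything
  later in the list, hence all selected elements other than \<open>q\<close>.\<close>
lemma greedy_witness:
  assumes "q \<in> greedy I \<delta> \<F> qs" "q \<notin> \<F>"
  shows "\<exists>X::('i, nat) rel_struct. is_struct I \<delta> X \<and> rep q \<prec> X \<and>
    (\<forall>f\<in>greedy I \<delta> \<F> qs. f \<noteq> q \<longrightarrow> \<not> rep f \<leadsto> X)"
  using assms
proof (induction qs arbitrary: \<F>)
  case (Cons p qs)
  show ?case
  proof (cases "\<exists>X::('i, nat) rel_struct. is_struct I \<delta> X \<and> rep p \<prec> X \<and>
      (\<forall>f\<in>\<F>. \<not> rep f \<leadsto> X) \<and> (\<forall>p\<in>set qs. \<not> rep p \<leadsto> X)")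
    case False
    then have "greedy I \<delta> \<F> (p # qs) = greedy I \<delta> \<F> qs"
      by (simp only: greedy.simps if_False)
    then show ?thesis using Cons by simp
  next
    case True
    then have eq: "greedy I \<delta> \<F> (p # qs) = greedy I \<delta> (insert p \<F>) qs"
      by (simp only: greedy.simps if_True)
    show ?thesis
    proof (cases "q = p")
      case False
      then show ?thesis using Cons eq by simp
    next
      case qp: True
      have "greedy I \<delta> (insert p \<F>) qs \<subseteq> insert p \<F> \<union> set qs"
        using greedy_bounds by blast
      then show ?thesis using True qp unfolding eq by blast
    qed
  qed
qed simp

section \<open>Heights and balanced structures\<close>

abbreviation linked :: "('i, 'v) rel_struct \<Rightarrow> ('v \<times> 'v) set" where
  "linked A \<equiv> (adjacent (shadow A))\<^sup>*"

lemma adjacentE: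
  assumes "(u, v) \<in> adjacent (shadow A)"
  obtains i xs j where "xs \<in> rel A i" "Suc j < length xs"
    "u = xs ! j \<and> v = xs ! Suc j \<or> v = xs ! j \<and> u = xs ! Suc j"
  using assms unfolding adjacent_def shadow_def by (auto simp: doubleton_eq_iff)

lemma adjacentI:
  assumes "xs \<in> rel A i" "Suc j < length xs"
  shows "(xs ! j, xs ! Suc j) \<in> adjacent (shadow A)"
  using assms unfolding adjacent_def shadow_def by force

lemma adjacent_sym: "(u, v) \<in> adjacent G \<Longrightarrow> (v, u) \<in> adjacent G"
  unfolding adjacent_def by (auto simp: insert_commute)

lemma linked_sym: "(u, v) \<in> linked A \<Longrightarrow> (v, u) \<in> linked A"
  using sym_rtrancl[of "adjacent (shadow A)"] adjacent_sym by (metis sym_def)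

lemma linked_hd_nth:
  assumes "xs \<in> rel A i" "j < length xs"
  shows "(xs ! 0, xs ! j) \<in> linked A"
  using assms(2)
proof (induction j)
  case (Suc j)
  then show ?case using adjacentI[OF assms(1), of j] by (auto intro: rtrancl_into_rtrancl)
qed simp

lemma linked_edge:
  assumes "xs \<in> rel A i" "u \<in> set xs" "v \<in> set xs"
  shows "(u, v) \<in> linked A"
proof -
  obtain j k where "j < length xs" "u = xs ! j" "k < length xs" "v = xs ! k"
    using assms by (auto simp: in_set_conv_nth)
  then have "(xs ! 0, u) \<in> linked A" "(xs ! 0, v) \<in> linked A"
    using linked_hd_nth[OF assms(1)] by auto
  then show ?thesis using linked_sym rtrancl_trans by fast
qed

lemma adjacent_in_base:
  assumes "is_struct I \<delta> A" "(u, v) \<in> adjacent (shadow A)"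
  shows "u \<in> base A" "v \<in> base A"
  using assms(2) struct_edgeD(3)[OF assms(1)] by (fastforce elim!: adjacentE dest: nth_mem Suc_lessD)+

lemma linked_in_base:
  assumes "is_struct I \<delta> A" "(u, v) \<in> linked A" "u \<in> base A"
  shows "v \<in> base A"
  using assms(2,3) by induction (use adjacent_in_base[OF assms(1)] in auto)

text \<open>The height for \<open>(i\<^sub>0, j\<^sub>0)\<close> is the coordinate for that generator of a homomorphism to a Cayley
  structure of a free abelian group.\<close>
definition height :: "'i \<Rightarrow> nat \<Rightarrow> ('i, 'v) rel_struct \<Rightarrow> ('v \<Rightarrow> int) \<Rightarrow> bool" where
  "height i\<^sub>0 j\<^sub>0 A h \<longleftrightarrow> (\<forall>i. \<forall>xs\<in>rel A i. \<forall>j. Suc j < length xs \<longrightarrow>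
     h (xs ! Suc j) = h (xs ! j) + (if i = i\<^sub>0 \<and> j = j\<^sub>0 then 1 else 0))"

definition balanced :: "('i, 'v) rel_struct \<Rightarrow> bool" where
  "balanced A \<longleftrightarrow> (\<forall>i j. \<exists>h. height i j A h)"

lemma heightD:
  assumes "height i\<^sub>0 j\<^sub>0 A h" "xs \<in> rel A i" "Suc j < length xs"
  shows "h (xs ! Suc j) = h (xs ! j) + (if i = i\<^sub>0 \<and> j = j\<^sub>0 then 1 else 0)"
  using assms unfolding height_def by blast

lemma height_pullback:
  assumes f: "is_hom f A B" and h: "height i j B h"
  shows "height i j A (h \<circ> f)"
  unfolding height_def
proof (intro allI ballI impI)
  fix k xs l assume xs: "xs \<in> rel A k" "Suc l < length xs"
  then have "map f xs \<in> rel B k" using f unfolding is_hom_def by blast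
  from heightD[OF h this, of l] xs
  show "(h \<circ> f) (xs ! Suc l) = (h \<circ> f) (xs ! l) + (if k = i \<and> l = j then 1 else 0)" by simp
qed

lemma balanced_pullback:
  assumes "A \<leadsto> B" "balanced B"
  shows "balanced A"
  using assms height_pullback unfolding balanced_def hom_to_def by metis

lemma height_trivial:
  assumes "is_struct I \<delta> A" "\<not> (i \<in> I \<and> Suc j < \<delta> i)"
  shows "height i j A (\<lambda>_. 0)"
  using assms struct_edgeD[OF assms(1)] unfolding height_def by auto

text \<open>Along a walk both heights change by the same amounts.\<close>
lemma height_differences_agree:
  assumes h: "height i j A h" and h': "height i j A h'" and uv: "(u, v) \<in> linked A"
  shows "h v - h u = h' v - h' u"
  using uv
proof induction
  case (step v w)
  from step.hyps(2) obtain k xs l where "xs \<in> rel A k" "Suc l < length xs"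
    "v = xs ! l \<and> w = xs ! Suc l \<or> w = xs ! l \<and> v = xs ! Suc l"
    by (rule adjacentE)
  then show ?case using step.IH heightD[OF h, of xs k l] heightD[OF h', of xs k l] by auto
qed simp

section \<open>Locally balanced structures from Ramsey's theorem\<close>

text \<open>
  Vertices carry an \<open>r\<close>-element set of naturals. Crossing position \<open>j\<^sub>0\<close> of an edge of kind \<open>i\<^sub>0\<close>
  shifts this set: with \<open>T\<close> of size \<open>Suc r\<close>, the set \<open>T\<close> without its maximum becomes \<open>T\<close> without its
  minimum. Everywhere else the set stays the same. A number that survives the shift loses exactly
  one in rank, so ranks serve as heights as long as few shifts are made; on the other hand the sets
  form a pattern found inside every set of size \<open>Suc r\<close>, which lets Ramsey's theorem transfer
  non-existence of homomorphisms from \<open>X\<close> to the product.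
\<close>
definition shift_product ::
    "'i \<Rightarrow> nat \<Rightarrow> nat \<Rightarrow> nat \<Rightarrow> ('i, 'v) rel_struct \<Rightarrow> ('i, 'v \<times> nat set) rel_struct" where
  "shift_product i\<^sub>0 j\<^sub>0 r N X =
     \<lparr>base = base X \<times> nsets {..<N} r,
      rel = (\<lambda>i. {map (\<lambda>p. (xs ! p, if i = i\<^sub>0 \<and> j\<^sub>0 < p then T - {Min T} else T - {Max T}))
                      [0..<length xs] | xs T. xs \<in> rel X i \<and> T \<in> nsets {..<N} (Suc r)})\<rparr>"

lemma shift_product_edge:
  assumes "ys \<in> rel (shift_product i\<^sub>0 j\<^sub>0 r N X) i"
  shows "\<exists>xs T. xs \<in> rel X i \<and> T \<in> nsets {..<N} (Suc r) \<and> length ys = length xs \<and>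
    (\<forall>p<length xs.
       ys ! p = (xs ! p, if i = i\<^sub>0 \<and> j\<^sub>0 < p then T - {Min T} else T - {Max T}))"
proof -
  obtain xs T where xs: "xs \<in> rel X i" "T \<in> nsets {..<N} (Suc r)" and
    ys: "ys = map (\<lambda>p. (xs ! p, if i = i\<^sub>0 \<and> j\<^sub>0 < p then T - {Min T} else T - {Max T}))
      [0..<length xs]"
    using assms unfolding shift_product_def by auto
  show ?thesis by (intro exI[of _ xs] exI[of _ T] conjI xs) (simp_all add: ys)
qed

lemma nsets_Suc_remove:
  fixes T :: "nat set"
  assumes "T \<in> nsets A (Suc r)"
  shows "finite T" "T \<noteq> {}" "T - {Min T} \<in> nsets A r" "T - {Max T} \<in> nsets A r"
proof -
  show T: "finite T" "T \<noteq> {}" using assms by (auto simp: nsets_def)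
  have "Min T \<in> T" "Max T \<in> T" using T by auto
  then show "T - {Min T} \<in> nsets A r" "T - {Max T} \<in> nsets A r"
    using assms by (auto simp: nsets_def)
qed

lemma shift_product_struct:
  assumes X: "is_struct I \<delta> X" and N: "r \<le> N"
  shows "is_struct I \<delta> (shift_product i\<^sub>0 j\<^sub>0 r N X)"
  unfolding is_struct_def
proof (intro conjI ballI allI impI)
  let ?P = "shift_product i\<^sub>0 j\<^sub>0 r N X"
  show "finite (base ?P)"
    using X by (simp add: is_struct_def shift_product_def finite_imp_finite_nsets)
  have "{..<r} \<in> nsets {..<N} r" using N by (auto simp: nsets_def)
  then show "base ?P \<noteq> {}" using X by (auto simp: is_struct_def shift_product_def)
  show "rel ?P i \<subseteq> {ys. length ys = \<delta> i \<and> set ys \<subseteq> base ?P}" if "i \<in> I" for i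
  proof
    fix ys assume "ys \<in> rel ?P i"
    from shift_product_edge[OF this] obtain xs T where ys: "xs \<in> rel X i" "T \<in> nsets {..<N} (Suc r)" "length ys = length xs"
      "\<forall>p<length xs.
         ys ! p = (xs ! p, if i = i\<^sub>0 \<and> j\<^sub>0 < p then T - {Min T} else T - {Max T})"
      by blast
    have "ys ! p \<in> base ?P" if "p < length ys" for p
      using that ys struct_edgeD(3)[OF X ys(1)] nsets_Suc_remove[OF ys(2)]
      by (auto simp: shift_product_def subset_iff)
    then have "set ys \<subseteq> base ?P" unfolding set_conv_nth by blast
    then show "ys \<in> {ys. length ys = \<delta> i \<and> set ys \<subseteq> base ?P}"
      using ys(3) struct_edgeD(2)[OF X ys(1)] by simp
  qed
  show "rel ?P i = {}" if "i \<notin> I" for i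
    using that struct_edgeD(1)[OF X] unfolding shift_product_def by auto
qed

lemma shift_product_proj: "shift_product i\<^sub>0 j\<^sub>0 r N X \<leadsto> X"
proof -
  have "map fst ys \<in> rel X i" if "ys \<in> rel (shift_product i\<^sub>0 j\<^sub>0 r N X) i" for i ys
  proof -
    from shift_product_edge[OF that]
    obtain xs T where ys: "xs \<in> rel X i" "length ys = length xs" "\<forall>p<length xs.
         ys ! p = (xs ! p, if i = i\<^sub>0 \<and> j\<^sub>0 < p then T - {Min T} else T - {Max T})"
      by blast
    then have "map fst ys = xs" by (intro nth_equalityI) auto
    then show ?thesis using ys(1) by simp
  qed
  then have "is_hom fst (shift_product i\<^sub>0 j\<^sub>0 r N X) X"
    unfolding is_hom_def by (auto simp: shift_product_def)
  then show ?thesis unfolding hom_to_def by blast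
qed

text \<open>A homomorphism \<open>f\<close> from the product colours each \<open>r\<close>-set \<open>s\<close> by the map \<open>\<lambda>x. f (x, s)\<close>. On a
  homogeneous \<open>T\<close> of size \<open>Suc r\<close> the two sets used by the shift have the same colour, and this
  colour is a homomorphism from \<open>X\<close>. The bound \<open>N\<close> depends on the target only through the finite
  set \<open>W\<close>, so it serves many targets simultaneously.\<close>
lemma shift_product_not_hom:
  fixes X :: "('i, 'v) rel_struct" and W :: "'w set"
  assumes X: "is_struct I \<delta> X" and W: "finite W"
  obtains N where "r \<le> N"
    "\<And>Q. base Q \<subseteq> W \<Longrightarrow> shift_product i\<^sub>0 j\<^sub>0 r N X \<leadsto> Q \<Longrightarrow> X \<leadsto> Q"
proof -
  let ?C = "base X \<rightarrow>\<^sub>E W"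
  have finC: "finite ?C" using X W by (auto simp: is_struct_def intro: finite_PiE)
  obtain col :: "('v \<Rightarrow> 'w) \<Rightarrow> nat" where col: "bij_betw col ?C {0..<card ?C}"
    using ex_bij_betw_finite_nat[OF finC] by blast
  obtain N\<^sub>0 :: nat where N\<^sub>0: "partn_lst {..<N\<^sub>0} (replicate (card ?C) (Suc r)) r"
    using ramsey_full by blast
  define N where "N = max N\<^sub>0 r"
  have N: "partn_lst {..<N} (replicate (card ?C) (Suc r)) r"
    using partn_lst_greater_resource[OF N\<^sub>0] by (simp add: N_def)
  have "X \<leadsto> Q" if Q: "base Q \<subseteq> W" and hom: "shift_product i\<^sub>0 j\<^sub>0 r N X \<leadsto> Q" for Q
  proof -
    obtain f where f: "is_hom f (shift_product i\<^sub>0 j\<^sub>0 r N X) Q"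
      using hom unfolding hom_to_def by blast
    define F where "F s = restrict (\<lambda>x. f (x, s)) (base X)" for s
    have F: "F s \<in> ?C" if "s \<in> nsets {..<N} r" for s
      using f that Q unfolding F_def is_hom_def shift_product_def by auto
    have "(\<lambda>s. col (F s)) \<in> nsets {..<N} r \<rightarrow> {..<card ?C}"
      using F bij_betwE[OF col] by simp
    with N have "\<exists>k<card ?C.
        monochromatic {..<N} (replicate (card ?C) (Suc r) ! k) r (\<lambda>s. col (F s)) k"
      unfolding partn_lst_def by simp
    then obtain k T where T: "T \<in> nsets {..<N} (Suc r)"
      "(\<lambda>s. col (F s)) ` nsets T r \<subseteq> {k}"
      unfolding monochromatic_def by (metis nth_replicate)
    note T' = nsets_Suc_remove[OF T(1)]
    have "T \<in> nsets T (Suc r)" using T by (auto simp: nsets_def)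
    from nsets_Suc_remove(3,4)[OF this] T(2)
    have "col (F (T - {Min T})) = col (F (T - {Max T}))" by (simp add: image_subset_iff)
    then have eq: "F (T - {Min T}) = F (T - {Max T})"
      using inj_onD[OF bij_betw_imp_inj_on[OF col] _ F[OF T'(3)] F[OF T'(4)]] by blast
    then have eq': "f (x, T - {Min T}) = f (x, T - {Max T})" if "x \<in> base X" for x
      using that fun_cong[OF eq, of x] unfolding F_def restrict_apply by simp
    have "is_hom (\<lambda>x. f (x, T - {Max T})) X Q"
      unfolding is_hom_def
    proof (intro conjI ballI allI)
      fix x assume "x \<in> base X"
      then show "f (x, T - {Max T}) \<in> base Q"
        using f T'(4) unfolding is_hom_def shift_product_def by auto
    next
      fix i xs assume xs: "xs \<in> rel X i"
      let ?ys = "map (\<lambda>p. (xs ! p, if i = i\<^sub>0 \<and> j\<^sub>0 < p then T - {Min T} else T - {Max T}))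
        [0..<length xs]"
      have "?ys \<in> rel (shift_product i\<^sub>0 j\<^sub>0 r N X) i"
        using xs T(1) unfolding shift_product_def by auto
      then have "map f ?ys \<in> rel Q i" using f unfolding is_hom_def by blast
      moreover have "map f ?ys = map (\<lambda>x. f (x, T - {Max T})) xs"
        using eq' struct_edgeD(3)[OF X xs] by (intro nth_equalityI) (auto simp: subset_iff)
      ultimately show "map (\<lambda>x. f (x, T - {Max T})) xs \<in> rel Q i" by simp
    qed
    then show ?thesis unfolding hom_to_def by blast
  qed
  then show ?thesis using that[of N] by (simp add: N_def)
qed

lemma rank_remove:
  fixes T :: "nat set"
  assumes T: "finite T" "T \<noteq> {}" and y: "y \<in> T" "y \<noteq> Min T"
  shows "Suc (card {z \<in> T - {Min T}. z < y}) = card {z \<in> T - {Max T}. z < y}"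
proof -
  have lt: "Min T < y" using T y Min_le[of T y] by linarith
  have "y \<le> Max T" "Min T \<in> T" using T y by auto
  with lt have "{z \<in> T - {Max T}. z < y} = insert (Min T) {z \<in> T - {Min T}. z < y}"
    by (auto simp del: Max_ge Min_le Min_in Max_in)
  then show ?thesis using T by simp
qed

lemma exists_rank:
  fixes t :: "nat set"
  assumes "finite t" "m < card t"
  shows "\<exists>y\<in>t. card {z \<in> t. z < y} = m"
  using assms
proof (induction t rule: finite_linorder_max_induct)
  case (insert b A)
  then have "b \<notin> A" by blast
  show ?case
  proof (cases "m < card A")
    case True
    then obtain y where y: "y \<in> A" "card {z \<in> A. z < y} = m" using insert by blast
    then have "{z \<in> insert b A. z < y} = {z \<in> A. z < y}" using insert.hyps(2) by force
    then show ?thesis using y by (metis insertI2)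
  next
    case False
    then have "m = card A" using insert \<open>b \<notin> A\<close> by simp
    moreover have "{z \<in> insert b A. z < b} = A" using insert.hyps(2) by auto
    ultimately show ?thesis by simp
  qed
qed simp

text \<open>In each component fix a root and the element of middle rank in the set at the root. As walks in
  \<open>A\<close> need at most \<open>n * n\<close> steps and each step moves the rank by at most one, this element stays
  in the sets of the whole component, and its negated rank is a height.\<close>
lemma shift_small_height:
  fixes A :: "('i, 'v) rel_struct"
  assumes A: "is_struct I \<delta> A" and n: "card (base A) \<le> n" and r: "2 * (n * n) < r"
    and hom: "A \<leadsto> shift_product i\<^sub>0 j\<^sub>0 r N X"
  shows "\<exists>h. height i\<^sub>0 j\<^sub>0 A h"
proof -
  obtain g where g: "is_hom g A (shift_product i\<^sub>0 j\<^sub>0 r N X)"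
    using hom unfolding hom_to_def by blast
  define s where "s v = snd (g v)" for v
  define rk where "rk y v = card {z \<in> s v. z < y}" for y v
  have s: "s v \<in> nsets {..<N} r" if "v \<in> base A" for v
    using g that unfolding is_hom_def s_def shift_product_def by fastforce
  have edge: "\<exists>T. T \<in> nsets {..<N} (Suc r) \<and>
      (\<forall>p<length xs. s (xs ! p) = (if i = i\<^sub>0 \<and> j\<^sub>0 < p then T - {Min T} else T - {Max T}))"
    if "xs \<in> rel A i" for i xs
  proof -
    have "map g xs \<in> rel (shift_product i\<^sub>0 j\<^sub>0 r N X) i"
      using g that unfolding is_hom_def by blast
    from shift_product_edge[OF this] obtain us T where
      "T \<in> nsets {..<N} (Suc r)" "length xs = length us" "\<forall>p<length us.
         map g xs ! p = (us ! p, if i = i\<^sub>0 \<and> j\<^sub>0 < p then T - {Min T} else T - {Max T})"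
      by auto
    then show ?thesis by (auto simp: s_def)
  qed
  have adj: "y \<in> s v \<and> rk y u \<le> rk y v + 1 \<and> rk y v \<le> rk y u + 1"
    if uv: "(u, v) \<in> adjacent (shadow A)" and y: "y \<in> s u" "0 < rk y u" "Suc (rk y u) < r"
    for u v y
  proof -
    from uv obtain i xs j where xs: "xs \<in> rel A i" "Suc j < length xs"
      "u = xs ! j \<and> v = xs ! Suc j \<or> v = xs ! j \<and> u = xs ! Suc j"
      by (rule adjacentE)
    obtain T where T: "T \<in> nsets {..<N} (Suc r)"
      "\<forall>p<length xs. s (xs ! p) = (if i = i\<^sub>0 \<and> j\<^sub>0 < p then T - {Min T} else T - {Max T})"
      using edge[OF xs(1)] by blast
    note T' = nsets_Suc_remove[OF T(1)]
    consider "s u = s v" | "s u = T - {Max T}" "s v = T - {Min T}"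
      | "s u = T - {Min T}" "s v = T - {Max T}"
      using xs(2,3) T(2)[rule_format, of j] T(2)[rule_format, of "Suc j"]
      by (cases "i = i\<^sub>0 \<and> j\<^sub>0 < j"; cases "i = i\<^sub>0 \<and> j\<^sub>0 < Suc j") auto
    then show ?thesis
    proof cases
      case 1
      then show ?thesis using y by (simp add: rk_def)
    next
      case 2
      have "{z \<in> T - {Max T}. z < Min T} = {}"
        using T'(1) by (auto simp: not_less)
      then have "y \<noteq> Min T" using y(2) 2 unfolding rk_def by (metis card.empty less_irrefl)
      then show ?thesis using 2 y rank_remove[OF T'(1,2), of y] by (auto simp: rk_def)
    next
      case 3
      have "z < Max T" if "z \<in> T - {Max T}" for z
        using that Max_ge[OF T'(1), of z] by (simp add: le_neq_implies_less)
      then have "{z \<in> T - {Min T}. z < Max T} = T - {Min T} - {Max T}" by blast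
      then have "rk (Max T) u = card (T - {Min T} - {Max T})" by (simp only: rk_def 3(1))
      moreover have "card (T - {Min T} - {Max T}) \<ge> r - 1"
        using diff_card_le_card_Diff[of "{Max T}" "T - {Min T}"] T'(3) by (simp add: nsets_def)
      ultimately have "r - 1 \<le> rk (Max T) u" by simp
      then have "rk y u \<noteq> rk (Max T) u" using y(3) by linarith
      then have "y \<noteq> Max T" by blast
      then show ?thesis using 3 y rank_remove[OF T'(1,2), of y] by (auto simp: rk_def)
    qed
  qed
  define m where "m = n * n"
  have walk: "y \<in> s v \<and> m \<le> rk y v + d \<and> rk y v \<le> m + d"
    if "(u, v) \<in> adjacent (shadow A) ^^ d" "y \<in> s u" "rk y u = m" "d \<le> m" for u v y d
    using that(1,4)
  proof (induction d arbitrary: v)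
    case 0
    then show ?case using that by simp
  next
    case (Suc d)
    then obtain w where w: "(u, w) \<in> adjacent (shadow A) ^^ d" "(w, v) \<in> adjacent (shadow A)"
      by auto
    have IH: "y \<in> s w" "m \<le> rk y w + d" "rk y w \<le> m + d" using Suc.IH[OF w(1)] Suc.prems by auto
    then show ?case using adj[OF w(2), of y] Suc.prems r by (simp add: m_def)
  qed
  have linked_walk: "\<exists>d\<le>m. (u, v) \<in> adjacent (shadow A) ^^ d"
    if uv: "(u, v) \<in> linked A" for u v
  proof -
    have sub: "adjacent (shadow A) \<subseteq> base A \<times> base A"
      using adjacent_in_base[OF A] by auto
    have fin: "finite (base A \<times> base A)" using A by (simp add: is_struct_def)
    have "card (adjacent (shadow A)) \<le> card (base A) * card (base A)"
      using card_mono[OF fin sub] by (simp add: card_cartesian_product)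
    also have "\<dots> \<le> m" using n by (simp add: m_def mult_le_mono)
    finally have le: "card (adjacent (shadow A)) \<le> m" .
    obtain d where "d \<le> card (adjacent (shadow A))" "(u, v) \<in> adjacent (shadow A) ^^ d"
      using uv unfolding rtrancl_finite_eq_relpow[OF finite_subset[OF sub fin]] by auto
    then show ?thesis using le le_trans by blast
  qed
  define root where "root v = (SOME u. (v, u) \<in> linked A)" for v
  have root: "(v, root v) \<in> linked A" for v
    unfolding root_def by (rule someI[of _ v]) simp
  have root_eq: "root u = root v" if "(u, v) \<in> linked A" for u v
  proof -
    have "(u, w) \<in> linked A \<longleftrightarrow> (v, w) \<in> linked A" for w
      using that linked_sym[OF that] rtrancl_trans by metis
    then show ?thesis unfolding root_def by simp
  qed
  have middle: "\<exists>y. y \<in> t \<and> card {z \<in> t. z < y} = m" if "t \<in> nsets {..<N} r" for t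
    using that r exists_rank[of t m] by (auto simp: nsets_def m_def)
  define mid where "mid v = (SOME y. y \<in> s (root v) \<and> rk y (root v) = m)" for v
  have mid: "mid v \<in> s (root v)" "rk (mid v) (root v) = m" if "v \<in> base A" for v
  proof -
    have "root v \<in> base A" using linked_in_base[OF A root that] .
    then have "\<exists>y. y \<in> s (root v) \<and> rk y (root v) = m"
      using middle[OF s] unfolding rk_def by blast
    then show "mid v \<in> s (root v)" "rk (mid v) (root v) = m"
      unfolding mid_def by (metis (mono_tags, lifting) someI_ex)+
  qed
  have mid_in: "mid v \<in> s v" if "v \<in> base A" for v
    using linked_walk[OF linked_sym[OF root[of v]]] walk mid[OF that] by blast
  have "height i\<^sub>0 j\<^sub>0 A (\<lambda>v. - int (rk (mid v) v))"
    unfolding height_def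
  proof (intro allI ballI impI)
    fix i xs j assume xs: "xs \<in> rel A i" "Suc j < length xs"
    let ?u = "xs ! j" and ?v = "xs ! Suc j"
    have base: "?u \<in> base A" "?v \<in> base A"
      using adjacent_in_base[OF A adjacentI[OF xs]] by auto
    have "(?u, ?v) \<in> linked A" using adjacentI[OF xs] by blast
    then have mid_eq: "mid ?u = mid ?v" using root_eq by (simp add: mid_def)
    obtain T where T: "T \<in> nsets {..<N} (Suc r)"
      "\<forall>p<length xs. s (xs ! p) = (if i = i\<^sub>0 \<and> j\<^sub>0 < p then T - {Min T} else T - {Max T})"
      using edge[OF xs(1)] by blast
    show "- int (rk (mid ?v) ?v) = - int (rk (mid ?u) ?u) + (if i = i\<^sub>0 \<and> j = j\<^sub>0 then 1 else 0)"
    proof (cases "i = i\<^sub>0 \<and> j = j\<^sub>0")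
      case True
      then have "s ?u = T - {Max T}" "s ?v = T - {Min T}" using T(2) xs by auto
      moreover from this have "mid ?v \<in> T" "mid ?v \<noteq> Min T" using mid_in[OF base(2)] by auto
      ultimately show ?thesis
        using True mid_eq rank_remove[OF nsets_Suc_remove(1,2)[OF T(1)], of "mid ?v"]
        by (simp add: rk_def)
    next
      case False
      then have "s ?u = s ?v" using T(2) xs by auto
      then show ?thesis using False mid_eq by (auto simp: rk_def)
    qed
  qed
  then show ?thesis by blast
qed

text \<open>The shift products for the finitely many pairs \<open>(i, j)\<close> are applied one after the other.
  Heights obtained at earlier stages survive because each product projects to its predecessor.\<close>
lemma locally_balanced_cover:
  fixes X :: "('i, nat) rel_struct" and W :: "nat set"
  assumes I: "finite I" and X: "is_struct I \<delta> X" and W: "finite W"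
  obtains X' :: "('i, nat) rel_struct" where "is_struct I \<delta> X'" "X' \<leadsto> X"
    "\<And>Q. base Q \<subseteq> W \<Longrightarrow> X' \<leadsto> Q \<Longrightarrow> X \<leadsto> Q"
    "\<And>A :: ('i, nat) rel_struct.
       is_struct I \<delta> A \<Longrightarrow> card (base A) \<le> n \<Longrightarrow> A \<leadsto> X' \<Longrightarrow> balanced A"
proof -
  \<comment> \<open>Room for \<open>n * n\<close> steps in either direction from the middle rank.\<close>
  define r where "r = Suc (2 * (n * n))"
  have *: "\<exists>X' :: ('i, nat) rel_struct. is_struct I \<delta> X' \<and> X' \<leadsto> X \<and>
      (\<forall>Q. base Q \<subseteq> W \<longrightarrow> X' \<leadsto> Q \<longrightarrow> X \<leadsto> Q) \<and>
      (\<forall>A :: ('i, nat) rel_struct. is_struct I \<delta> A \<longrightarrow> card (base A) \<le> n \<longrightarrow> A \<leadsto> X' \<longrightarrow>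
         (\<forall>(i, j)\<in>L. \<exists>h. height i j A h))"
    if "finite L" for L :: "('i \<times> nat) set"
    using that
  proof (induction L)
    case empty
    then show ?case using X hom_to_refl by blast
  next
    case (insert l L)
    obtain i j where l: "l = (i, j)" by fastforce
    from insert.IH obtain Y :: "('i, nat) rel_struct" where Y: "is_struct I \<delta> Y" "Y \<leadsto> X"
      "\<forall>Q. base Q \<subseteq> W \<longrightarrow> Y \<leadsto> Q \<longrightarrow> X \<leadsto> Q"
      "\<forall>A :: ('i, nat) rel_struct. is_struct I \<delta> A \<longrightarrow> card (base A) \<le> n \<longrightarrow> A \<leadsto> Y \<longrightarrow>
         (\<forall>(i, j)\<in>L. \<exists>h. height i j A h)"
      by blast
    obtain N where N: "r \<le> N"
      "\<And>Q. base Q \<subseteq> W \<Longrightarrow> shift_product i j r N Y \<leadsto> Q \<Longrightarrow> Y \<leadsto> Q"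
      using shift_product_not_hom[OF Y(1) W] by blast
    let ?P = "shift_product i j r N Y"
    obtain Z :: "('i, nat) rel_struct" where Z: "is_struct I \<delta> Z" "?P \<leadsto> Z" "Z \<leadsto> ?P"
      using nat_copy[OF shift_product_struct[OF Y(1) N(1)]] by blast
    have ZY: "Z \<leadsto> Y" by (rule hom_to_trans[OF Z(3) shift_product_proj])
    show ?case
    proof (intro exI[of _ Z] conjI allI impI)
      show "Z \<leadsto> X" by (rule hom_to_trans[OF ZY Y(2)])
      fix Q :: "('i, nat) rel_struct" assume "base Q \<subseteq> W" "Z \<leadsto> Q"
      then show "X \<leadsto> Q" using Y(3) N(2) hom_to_trans[OF Z(2)] by blast
    next
      fix A :: "('i, nat) rel_struct"
      assume A: "is_struct I \<delta> A" "card (base A) \<le> n" "A \<leadsto> Z"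
      have "\<exists>h. height i j A h"
        by (rule shift_small_height[OF A(1,2) _ hom_to_trans[OF A(3) Z(3)]]) (simp add: r_def)
      moreover have "\<forall>(i, j)\<in>L. \<exists>h. height i j A h"
        using Y(4) A(1,2) hom_to_trans[OF A(3) ZY] by blast
      ultimately show "\<forall>(i, j)\<in>insert l L. \<exists>h. height i j A h" by (simp add: l)
    qed (rule Z(1))
  qed
  have "finite (SIGMA i:I. {..<\<delta> i})" using I by auto
  from *[OF this] obtain X' :: "('i, nat) rel_struct" where X': "is_struct I \<delta> X'" "X' \<leadsto> X"
    "\<forall>Q. base Q \<subseteq> W \<longrightarrow> X' \<leadsto> Q \<longrightarrow> X \<leadsto> Q"
    "\<forall>A :: ('i, nat) rel_struct. is_struct I \<delta> A \<longrightarrow> card (base A) \<le> n \<longrightarrow> A \<leadsto> X' \<longrightarrow>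
       (\<forall>(i, j)\<in>(SIGMA i:I. {..<\<delta> i}). \<exists>h. height i j A h)"
    by blast
  have "balanced A" if A: "is_struct I \<delta> A" "card (base A) \<le> n" "A \<leadsto> X'"
    for A :: "('i, nat) rel_struct"
    unfolding balanced_def
  proof (intro allI)
    fix i j
    show "\<exists>h. height i j A h"
    proof (cases "i \<in> I \<and> Suc j < \<delta> i")
      case True
      then have "(i, j) \<in> (SIGMA i:I. {..<\<delta> i})" by simp
      then show ?thesis using X'(4) A by blast
    qed (use height_trivial[OF A(1)] in blast)
  qed
  then show ?thesis using that X' by blast
qed

section \<open>Balanced structures that do not map to \<open>D*\<close>\<close>

lemma finite_rel:
  assumes "is_struct I \<delta> A"
  shows "finite (rel A i)"
proof -
  have "rel A i \<subseteq> {xs. set xs \<subseteq> base A \<and> length xs = \<delta> i}"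
    using struct_edgeD[OF assms] by blast
  then show ?thesis
    using assms finite_subset[OF _ finite_lists_length_eq] unfolding is_struct_def by blast
qed

text \<open>The height of the pair \<open>(i, j)\<close> belonging to the first edge of a cycle changes on that edge, and
  on no other edge of the cycle, since only this edge of the shadow belongs to \<open>(i, j)\<close>. So the
  cycle cannot close up.\<close>
lemma balanced_no_cycle:
  assumes T: "is_struct I \<delta> T" and bal: "balanced T" and one: "\<forall>i\<in>I. card (rel T i) \<le> 1"
  shows "\<not> is_cycle (shadow T) vs es"
proof
  assume cyc: "is_cycle (shadow T) vs es"
  define n where "n = length vs"
  have n: "0 < n" "length es = n" "distinct es" using cyc by (auto simp: is_cycle_def n_def)
  have one': "xs = xs'" if "xs \<in> rel T i" "xs' \<in> rel T i" for i xs xs'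
    using one struct_edgeD(1)[OF T that(1)] that finite_rel[OF T, of i]
    by (metis One_nat_def card_le_Suc0_iff_eq)
  have es: "\<exists>i xs j. es ! k = (i, xs, j) \<and> xs \<in> rel T i \<and> Suc j < length xs \<and>
      (vs ! k = xs ! j \<and> vs ! (Suc k mod n) = xs ! Suc j \<or>
       vs ! k = xs ! Suc j \<and> vs ! (Suc k mod n) = xs ! j)" if k: "k < n" for k
  proof -
    obtain i xs j where e: "es ! k = (i, xs, j)" by (metis prod_cases3)
    have "es ! k \<in> edges (shadow T)" "ends (shadow T) (es ! k) = {vs ! k, vs ! (Suc k mod n)}"
      using cyc k nth_mem[of k es] unfolding is_cycle_def n_def by auto
    then show ?thesis using e by (auto simp: shadow_def doubleton_eq_iff)
  qed
  obtain i xs j where e0: "es ! 0 = (i, xs, j)" "xs \<in> rel T i" "Suc j < length xs"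
    "vs ! 0 = xs ! j \<and> vs ! (Suc 0 mod n) = xs ! Suc j \<or>
     vs ! 0 = xs ! Suc j \<and> vs ! (Suc 0 mod n) = xs ! j"
    using es[OF n(1)] by blast
  obtain h where h: "height i j T h" using bal unfolding balanced_def by blast
  have first: "h (vs ! 0) \<noteq> h (vs ! (Suc 0 mod n))"
    using e0(4) heightD[OF h e0(2,3)] by auto
  have others: "h (vs ! (Suc k mod n)) = h (vs ! k)" if k: "0 < k" "k < n" for k
  proof -
    obtain i' xs' j' where e: "es ! k = (i', xs', j')" "xs' \<in> rel T i'" "Suc j' < length xs'"
      "vs ! k = xs' ! j' \<and> vs ! (Suc k mod n) = xs' ! Suc j' \<or>
       vs ! k = xs' ! Suc j' \<and> vs ! (Suc k mod n) = xs' ! j'"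
      using es[OF k(2)] by blast
    have "es ! k \<noteq> es ! 0" using n k by (simp add: nth_eq_iff_index_eq)
    then have "\<not> (i' = i \<and> j' = j)" using e(1,2) e0(1,2) one' by auto
    then have "h (xs' ! Suc j') = h (xs' ! j')" using heightD[OF h e(2,3)] by auto
    then show ?thesis using e(4) by auto
  qed
  have "h (vs ! (Suc k mod n)) = h (vs ! (Suc 0 mod n))" if "k < n" for k
    using that
  proof (induction k)
    case (Suc k)
    then show ?case using others[of "Suc k"] by simp
  qed simp
  from this[of "n - 1"] n(1) first show False by simp
qed

lemma tree_to_D_star:
  fixes T :: "('i, nat) rel_struct"
  assumes "is_struct_tree I \<delta> T" "\<forall>i\<in>I. card (rel T i) \<le> 1"
  shows "T \<leadsto> D_star I \<delta>"
proof -
  define S :: "('i, nat) rel_struct set"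
    where "S = {T. is_struct_tree I \<delta> T \<and> (\<forall>i\<in>I. card (rel T i) \<le> 1)}"
  define c where "c = (iso_rel \<inter> S \<times> S) `` {T}"
  have TS: "T \<in> S" using assms by (simp add: S_def)
  have T: "is_struct I \<delta> T" using assms(1) by (simp add: is_struct_tree_def)
  have c: "c \<in> iso_classes S"
    using TS unfolding iso_classes_def c_def by (rule quotientI)
  have "is_hom (Pair c) (rep c) (struct_sum (iso_classes S) rep)"
    using c unfolding is_hom_def struct_sum_def by auto
  then have "rep c \<leadsto> D_star I \<delta>"
    unfolding hom_to_def D_star_def S_def[symmetric] by blast
  with isomorphic_homs(1)[OF T rep_in_class(2)[OF TS c_def]] show ?thesis by (rule hom_to_trans)
qed

text \<open>Identify the vertices of the component that agree in all heights. Edges of the same kind whose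
  first entries are identified become equal, so the quotient is a tree with at most one edge of
  each kind, a summand of \<open>D*\<close>.\<close>
lemma component_to_D_star:
  fixes A :: "('i, 'v) rel_struct"
  assumes A: "is_struct I \<delta> A" and bal: "balanced A" and v: "v \<in> base A"
    and same: "\<And>i xs ys i\<^sub>0 j\<^sub>0 h. xs \<in> rel A i \<Longrightarrow> ys \<in> rel A i \<Longrightarrow> (xs ! 0, ys ! 0) \<in> linked A \<Longrightarrow>
      height i\<^sub>0 j\<^sub>0 A h \<Longrightarrow> h (xs ! 0) = h (ys ! 0)"
  shows "induced A (linked A `` {v}) \<leadsto> D_star I \<delta>"
proof -
  let ?C = "linked A `` {v}"
  let ?A = "induced A ?C"
  have C: "?C \<subseteq> base A" "?C \<noteq> {}" using linked_in_base[OF A] v by auto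
  have "\<forall>i. \<forall>j. \<exists>h. height i j A h" using bal by (simp add: balanced_def)
  then obtain H where H: "\<And>i j. height i j A (H i j)" by metis
  define p where "p v = (\<lambda>i j. H i j v)" for v
  have "finite (p ` base A)" using A by (simp add: is_struct_def)
  then obtain \<kappa> :: "('i \<Rightarrow> nat \<Rightarrow> int) \<Rightarrow> nat" where \<kappa>: "inj_on \<kappa> (p ` base A)"
    using finite_imp_inj_to_nat_seg by metis
  define q where "q v = \<kappa> (p v)" for v
  have q_eq: "q u = q w \<longleftrightarrow> p u = p w" if "u \<in> base A" "w \<in> base A" for u w
    using that \<kappa> by (auto simp: q_def inj_on_def)
  define T where "T = hom_image q ?A"
  have T: "is_struct I \<delta> T"
    unfolding T_def by (rule hom_image_struct[OF induced_struct[OF A C]])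
  have hom: "is_hom q ?A T" unfolding T_def by (rule hom_image_hom)
  have edge_in_C: "xs \<in> rel ?A i" if "xs \<in> rel A i" "u \<in> set xs" "u \<in> ?C" for xs i u
    using that linked_edge[OF that(1,2)] rtrancl_trans[of v u "adjacent (shadow A)"]
    by (auto simp: induced_def)
  have relT: "\<exists>xs. xs \<in> rel A i \<and> set xs \<subseteq> ?C \<and> ys = map q xs" if "ys \<in> rel T i" for ys i
    using that unfolding T_def hom_image_def induced_def by auto
  have "balanced T"
    unfolding balanced_def
  proof (intro allI exI)
    fix i j
    let ?h = "\<lambda>n. H i j (inv_into (base A) q n)"
    have h: "?h (q w) = H i j w" if "w \<in> base A" for w
    proof -
      have "q (inv_into (base A) q (q w)) = q w" using that by (simp add: f_inv_into_f)
      then have "p (inv_into (base A) q (q w)) = p w"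
        using q_eq that by (simp add: inv_into_into)
      then show ?thesis unfolding p_def by meson
    qed
    show "height i j T ?h"
      unfolding height_def
    proof (intro allI ballI impI)
      fix k ys l assume ys: "ys \<in> rel T k" "Suc l < length ys"
      obtain xs where xs: "xs \<in> rel A k" "ys = map q xs" using relT[OF ys(1)] by blast
      have "xs ! l \<in> base A" "xs ! Suc l \<in> base A"
        using adjacent_in_base[OF A adjacentI[OF xs(1)]] ys(2) xs(2) by auto
      then show "?h (ys ! Suc l) = ?h (ys ! l) + (if k = i \<and> l = j then 1 else 0)"
        using heightD[OF H xs(1), of l] ys(2) xs(2) by (simp add: h)
    qed
  qed
  moreover have one: "\<forall>i\<in>I. card (rel T i) \<le> 1"
  proof
    fix i
    have "ys = ys'" if ys: "ys \<in> rel T i" and ys': "ys' \<in> rel T i" for ys ys'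
    proof -
      obtain xs where xs: "xs \<in> rel A i" "set xs \<subseteq> ?C" "ys = map q xs"
        using relT[OF ys] by blast
      obtain xs' where xs': "xs' \<in> rel A i" "set xs' \<subseteq> ?C" "ys' = map q xs'"
        using relT[OF ys'] by blast
      have len: "length xs = length xs'"
        using struct_edgeD(2)[OF A xs(1)] struct_edgeD(2)[OF A xs'(1)] by simp
      have "p (xs ! l) = p (xs' ! l)" if "l < length xs" for l
        using that
      proof (induction l)
        case 0
        then have "xs ! 0 \<in> ?C" "xs' ! 0 \<in> ?C" using xs(2) xs'(2) len by (auto simp: subset_iff)
        then have "(xs ! 0, xs' ! 0) \<in> linked A"
          using linked_sym rtrancl_trans by (metis Image_singleton_iff)
        then show ?case using same[OF xs(1) xs'(1) _ H] by (simp add: p_def)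
      next
        case (Suc l)
        then have "H i' j' (xs ! l) = H i' j' (xs' ! l)" for i' j'
          unfolding p_def by (metis Suc_lessD)
        then show ?case
          using Suc.prems len heightD[OF H xs(1), of l] heightD[OF H xs'(1), of l]
          by (simp add: p_def)
      qed
      then show ?thesis using xs(3) xs'(3) len by (intro nth_equalityI) (auto simp: q_def)
    qed
    then show "card (rel T i) \<le> 1"
      using finite_rel[OF T, of i] by (simp add: card_le_Suc0_iff_eq)
  qed
  moreover have "connected_multigraph (shadow T)"
  proof -
    have *: "(q v, q w) \<in> linked T" if "(v, w) \<in> linked A" for w
      using that
    proof induction
      case (step u w)
      obtain i xs j where xs: "xs \<in> rel A i" "Suc j < length xs"
        "u = xs ! j \<and> w = xs ! Suc j \<or> w = xs ! j \<and> u = xs ! Suc j"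
        using step.hyps(2) by (rule adjacentE)
      have "u \<in> set xs" using xs by auto
      then have "xs \<in> rel ?A i" using edge_in_C[OF xs(1)] step.hyps(1) by blast
      then have "map q xs \<in> rel T i" using hom unfolding is_hom_def by blast
      from adjacentI[OF this, of j] xs(2)
      have adj: "(q (xs ! j), q (xs ! Suc j)) \<in> adjacent (shadow T)" by simp
      have "(q u, q w) \<in> adjacent (shadow T)" using xs(3) adj adjacent_sym[OF adj] by auto
      with step.IH show ?case by (rule rtrancl_into_rtrancl)
    qed simp
    show ?thesis
      unfolding connected_multigraph_def
    proof (intro ballI)
      fix a b assume "a \<in> verts (shadow T)" "b \<in> verts (shadow T)"
      then obtain u w where "(v, u) \<in> linked A" "(v, w) \<in> linked A" "a = q u" "b = q w"
        by (auto simp: shadow_def T_def hom_image_def induced_def)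
      then show "(a, b) \<in> linked T" using * linked_sym rtrancl_trans by metis
    qed
  qed
  moreover have "verts (shadow T) \<noteq> {}" using T by (simp add: shadow_def is_struct_def)
  ultimately have "is_struct_tree I \<delta> T"
    using T balanced_no_cycle[OF T] unfolding is_struct_tree_def is_tree_def by blast
  from tree_to_D_star[OF this one] show ?thesis
    using hom hom_to_trans unfolding hom_to_def by metis
qed

lemma balanced_not_to_D_star:
  fixes A :: "('i, 'v) rel_struct"
  assumes ty: "is_type I \<delta>" and A: "is_struct I \<delta> A" and bal: "balanced A" and no: "\<not> A \<leadsto> D_star I \<delta>"
  obtains i xs ys i\<^sub>0 j\<^sub>0 h where "xs \<in> rel A i" "ys \<in> rel A i" "(xs ! 0, ys ! 0) \<in> linked A"
    "height i\<^sub>0 j\<^sub>0 A h" "h (xs ! 0) \<noteq> h (ys ! 0)"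
proof (rule ccontr)
  assume contr: "\<not> thesis"
  let ?C = "\<lambda>v. linked A `` {v}"
  have "\<forall>v\<in>base A. induced A (?C v) \<leadsto> D_star I \<delta>"
    using component_to_D_star[OF A bal] that contr by metis
  then have "\<forall>S. \<exists>g. (\<exists>v\<in>base A. S = ?C v) \<longrightarrow> is_hom g (induced A S) (D_star I \<delta>)"
    unfolding hom_to_def by blast
  then obtain G where G: "\<And>v. v \<in> base A \<Longrightarrow> is_hom (G (?C v)) (induced A (?C v)) (D_star I \<delta>)"
    by metis
  have C_eq: "?C u = ?C v" if "(u, v) \<in> linked A" for u v
    using that linked_sym[OF that] by (auto intro: rtrancl_trans)
  have "is_hom (\<lambda>v. G (?C v) v) A (D_star I \<delta>)"
    unfolding is_hom_def
  proof (intro conjI ballI allI)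
    fix v assume "v \<in> base A"
    then show "G (?C v) v \<in> base (D_star I \<delta>)"
      using G unfolding is_hom_def induced_def by simp
  next
    fix i xs assume xs: "xs \<in> rel A i"
    show "map (\<lambda>v. G (?C v) v) xs \<in> rel (D_star I \<delta>) i"
    proof (cases xs)
      case Nil
      then show ?thesis using struct_edgeD(1,2)[OF A xs] ty by (auto simp: is_type_def)
    next
      case (Cons v ws)
      then have v: "v \<in> set xs" by simp
      have vb: "v \<in> base A" using struct_edgeD(3)[OF A xs] v by blast
      have lk: "(v, w) \<in> linked A" if "w \<in> set xs" for w using linked_edge[OF xs v that] .
      then have "xs \<in> rel (induced A (?C v)) i" using xs by (auto simp: induced_def)
      then have "map (G (?C v)) xs \<in> rel (D_star I \<delta>) i"
        using G[OF vb] unfolding is_hom_def by blast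
      moreover have "map (\<lambda>v. G (?C v) v) xs = map (G (?C v)) xs"
        using C_eq[OF lk] by (intro map_cong) auto
      ultimately show ?thesis by (simp only:)
    qed
  qed
  then show False using no unfolding hom_to_def by blast
qed

section \<open>Destroying balance by a long zigzag\<close>

text \<open>
  The zigzag has levels \<open>0, \<dots>, L\<close>. Level 0 is the edge \<open>xs\<close> and level \<open>L\<close> is the edge \<open>ys\<close>; the
  levels in between consist of new vertices. Besides the edge on each level there is, for each
  \<open>k < L\<close>, an edge with first entry on level \<open>k\<close> and all other entries on level \<open>Suc k\<close>. Hence
  consecutive first entries have a common successor.
\<close>
definition rung :: "'v list \<Rightarrow> 'v list \<Rightarrow> nat \<Rightarrow> nat \<Rightarrow> nat \<Rightarrow> 'v + nat \<times> nat" where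
  "rung xs ys L j k = (if k = 0 then Inl (xs ! j) else if k = L then Inl (ys ! j) else Inr (j, k))"

definition zigzag ::
    "'i \<Rightarrow> 'v list \<Rightarrow> 'v list \<Rightarrow> nat \<Rightarrow> ('i, 'v) rel_struct \<Rightarrow> ('i, 'v + nat \<times> nat) rel_struct" where
  "zigzag i xs ys L A =
     \<lparr>base = Inl ` base A \<union> Inr ` ({..<length xs} \<times> {1..<L}),
      rel = (\<lambda>i'. map Inl ` rel A i' \<union>
        (if i' = i then
           {map (\<lambda>j. rung xs ys L j k) [0..<length xs] | k. k \<le> L} \<union>
           {map (\<lambda>j. rung xs ys L j (if j = 0 then k else Suc k)) [0..<length xs] | k. k < L}
         else {}))\<rparr>"

lemma zigzag_struct:
  assumes A: "is_struct I \<delta> A" and xs: "xs \<in> rel A i" and ys: "ys \<in> rel A i"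
  shows "is_struct I \<delta> (zigzag i xs ys L A)"
proof -
  let ?Z = "zigzag i xs ys L A"
  have len: "length xs = \<delta> i" "length ys = \<delta> i" and iI: "i \<in> I"
    using struct_edgeD[OF A] xs ys by blast+
  have "xs ! j \<in> base A" "ys ! j \<in> base A" if "j < \<delta> i" for j
    using that struct_edgeD(3)[OF A xs] struct_edgeD(3)[OF A ys] len by (auto simp: subset_iff)
  then have rung: "rung xs ys L j k \<in> base ?Z" if "j < \<delta> i" "k \<le> L" for j k
    using that len by (auto simp: rung_def zigzag_def)
  have "zs \<in> {zs. length zs = \<delta> i' \<and> set zs \<subseteq> base ?Z}" if zs: "zs \<in> rel ?Z i'" for zs i'
  proof -
    consider ws where "ws \<in> rel A i'" "zs = map Inl ws"
      | k where "i' = i" "k \<le> L" "zs = map (\<lambda>j. rung xs ys L j k) [0..<length xs]"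
      | k where "i' = i" "k < L"
          "zs = map (\<lambda>j. rung xs ys L j (if j = 0 then k else Suc k)) [0..<length xs]"
      using zs by (auto simp: zigzag_def split: if_splits)
    then show ?thesis
    proof cases
      case 1
      then show ?thesis using struct_edgeD[OF A 1(1)] by (auto simp: zigzag_def)
    next
      case 2
      then show ?thesis using rung len by auto
    next
      case 3
      then show ?thesis using rung len by auto
    qed
  qed
  moreover have "rel ?Z i' = {}" if "i' \<notin> I" for i'
  proof -
    have "rel A i' = {}" using A that by (simp add: is_struct_def)
    then show ?thesis using that iI by (auto simp: zigzag_def)
  qed
  moreover have "finite (base ?Z)" "base ?Z \<noteq> {}"
    using A by (auto simp: zigzag_def is_struct_def)
  ultimately show ?thesis unfolding is_struct_def by blast
qed

lemma zigzag_Inl: "is_hom Inl A (zigzag i xs ys L A)"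
  unfolding is_hom_def zigzag_def by auto

lemma zigzag_not_balanced:
  assumes A: "is_struct I \<delta> A" and ty: "is_type I \<delta>"
    and xs: "xs \<in> rel A i" and ys: "ys \<in> rel A i" and L: "0 < L"
    and lk: "(xs ! 0, ys ! 0) \<in> linked A"
    and h: "height i\<^sub>0 j\<^sub>0 A h" and ne: "h (xs ! 0) \<noteq> h (ys ! 0)"
  shows "\<not> balanced (zigzag i xs ys L A)"
proof
  let ?Z = "zigzag i xs ys L A" and ?u = "rung xs ys L"
  assume "balanced ?Z"
  then obtain f where f: "height i\<^sub>0 j\<^sub>0 ?Z f" unfolding balanced_def by blast
  have len: "0 < length xs" "Suc 0 < length xs"
    using struct_edgeD[OF A xs] ty by (force simp: is_type_def)+
  have "f (?u 0 (Suc k)) = f (?u 0 k)" if k: "k < L" for k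
  proof -
    let ?row = "map (\<lambda>j. ?u j (Suc k)) [0..<length xs]"
      and ?cross = "map (\<lambda>j. ?u j (if j = 0 then k else Suc k)) [0..<length xs]"
    have "?row \<in> rel ?Z i"
      unfolding zigzag_def using k by (auto intro!: exI[of _ "Suc k"])
    from heightD[OF f this, of 0] len
    have 1: "f (?u (Suc 0) (Suc k)) = f (?u 0 (Suc k)) + (if i = i\<^sub>0 \<and> 0 = j\<^sub>0 then 1 else 0)"
      by simp
    have "?cross \<in> rel ?Z i"
      unfolding zigzag_def using k by (auto intro!: exI[of _ k])
    from heightD[OF f this, of 0] len
    have 2: "f (?u (Suc 0) (Suc k)) = f (?u 0 k) + (if i = i\<^sub>0 \<and> 0 = j\<^sub>0 then 1 else 0)"
      by simp
    from 1 2 show ?thesis by linarith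
  qed
  then have "f (?u 0 k) = f (?u 0 0)" if "k \<le> L" for k
    using that by (induction k) auto
  from this[of L] L have "f (Inl (ys ! 0)) = f (Inl (xs ! 0))" by (simp add: rung_def)
  moreover have "h (ys ! 0) - h (xs ! 0) = (f \<circ> Inl) (ys ! 0) - (f \<circ> Inl) (xs ! 0)"
    by (rule height_differences_agree[OF h height_pullback[OF zigzag_Inl f] lk])
  ultimately show False using ne by simp
qed

text \<open>With more inner levels than vertices of \<open>B\<close>, the image of \<open>B\<close> misses a level \<open>m\<close>. The part of
  the zigzag below \<open>m\<close> then folds onto the edge \<open>xs\<close>, and the part above \<open>m\<close> onto \<open>ys\<close>.\<close>
lemma zigzag_small:
  fixes A :: "('i, 'v) rel_struct" and B :: "('i, 'w) rel_struct"
  assumes A: "is_struct I \<delta> A" and ty: "is_type I \<delta>"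
    and xs: "xs \<in> rel A i" and ys: "ys \<in> rel A i"
    and B: "is_struct I \<delta> B" "card (base B) + 1 < L" and hom: "B \<leadsto> zigzag i xs ys L A"
  shows "B \<leadsto> A"
proof -
  let ?Z = "zigzag i xs ys L A" and ?u = "rung xs ys L"
  obtain g where g: "is_hom g B ?Z" using hom unfolding hom_to_def by blast
  define level where "level z = (case z of Inl a \<Rightarrow> 0 | Inr (j, k) \<Rightarrow> k)" for z :: "'v + nat \<times> nat"
  have finB: "finite (base B)" using B by (simp add: is_struct_def)
  have "card ((level \<circ> g) ` base B) < card {1..<L}"
    using card_image_le[OF finB, of "level \<circ> g"] B(2) by simp
  then have "\<not> {1..<L} \<subseteq> (level \<circ> g) ` base B"
    using card_mono[OF finite_imageI[OF finB]] by (meson leD)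
  then obtain m where "m \<in> {1..<L}" "m \<notin> (level \<circ> g) ` base B" by blast
  then have m: "0 < m" "m < L" "\<And>v. v \<in> base B \<Longrightarrow> level (g v) \<noteq> m"
    by (auto simp: image_iff)
  have len: "0 < length xs" "Suc 0 < length xs" "length ys = length xs"
    using struct_edgeD[OF A xs] struct_edgeD[OF A ys] ty by (force simp: is_type_def)+
  define \<rho> where "\<rho> z = (case z of Inl a \<Rightarrow> a | Inr (j, k) \<Rightarrow> if k < m then xs ! j else ys ! j)"
    for z :: "'v + nat \<times> nat"
  have \<rho>_base: "\<rho> z \<in> base A" if "z \<in> base ?Z" for z
    using that struct_edgeD(3)[OF A xs] struct_edgeD(3)[OF A ys] len
    by (auto simp: zigzag_def \<rho>_def subset_iff)
  have below: "\<rho> (?u j k) = xs ! j" if "k < m" for j k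
    using that m by (simp add: rung_def \<rho>_def)
  have above: "\<rho> (?u j k) = ys ! j" if "m < k" for j k
    using that m by (simp add: rung_def \<rho>_def)
  have level_m: "level (?u j m) = m" for j
    using m by (simp add: rung_def level_def)
  have "map (\<rho> \<circ> g) ws \<in> rel A i'" if ws: "ws \<in> rel B i'" for ws i'
  proof -
    define zs where "zs = map g ws"
    have zs: "zs \<in> rel ?Z i'" using g ws unfolding is_hom_def zs_def by blast
    have avoid: "level z \<noteq> m" if "z \<in> set zs" for z
      using that m(3) struct_edgeD(3)[OF B(1) ws] by (auto simp: zs_def)
    consider ts where "ts \<in> rel A i'" "zs = map Inl ts"
      | k where "i' = i" "zs = map (\<lambda>j. ?u j k) [0..<length xs]"
      | k where "i' = i" "zs = map (\<lambda>j. ?u j (if j = 0 then k else Suc k)) [0..<length xs]"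
      using zs by (auto simp: zigzag_def split: if_splits)
    then have "map \<rho> zs \<in> rel A i'"
    proof cases
      case 1
      then show ?thesis by (simp add: \<rho>_def comp_def)
    next
      case 2
      have "zs ! 0 = ?u 0 k" "0 < length zs" using 2(2) len by auto
      then have "?u 0 k \<in> set zs" by (metis nth_mem)
      then have "k \<noteq> m" using avoid level_m by blast
      then consider "k < m" | "m < k" by linarith
      then have "map \<rho> zs = xs \<or> map \<rho> zs = ys"
      proof cases
        case 1
        then have "map \<rho> zs = xs" using below 2(2) by (intro nth_equalityI) auto
        then show ?thesis ..
      next
        case a: 2
        then have "map \<rho> zs = ys" using above 2(2) len by (intro nth_equalityI) auto
        then show ?thesis ..
      qed
      then show ?thesis using xs ys 2(1) by auto
    next
      case 3
      have "zs ! 0 = ?u 0 k" "0 < length zs" using 3(2) len by auto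
      moreover have "zs ! Suc 0 = ?u (Suc 0) (Suc k)" "Suc 0 < length zs" using 3(2) len by auto
      ultimately have "?u 0 k \<in> set zs" "?u (Suc 0) (Suc k) \<in> set zs" by (metis nth_mem)+
      then have "k \<noteq> m" "Suc k \<noteq> m" using avoid level_m by blast+
      then consider "k < m" "Suc k < m" | "m < k" "m < Suc k" by linarith
      then have "map \<rho> zs = xs \<or> map \<rho> zs = ys"
      proof cases
        case 1
        then have "map \<rho> zs = xs" using below 3(2) by (intro nth_equalityI) auto
        then show ?thesis ..
      next
        case 2
        then have "map \<rho> zs = ys" using above 3(2) len by (intro nth_equalityI) auto
        then show ?thesis ..
      qed
      then show ?thesis using xs ys 3(1) by auto
    qed
    then show ?thesis by (simp add: zs_def)
  qed
  moreover have "(\<rho> \<circ> g) v \<in> base A" if "v \<in> base B" for v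
    using that g \<rho>_base unfolding is_hom_def by simp
  ultimately show ?thesis unfolding hom_to_def is_hom_def by blast
qed

section \<open>The greedy partition splits the antichain\<close>

text \<open>The zigzag over \<open>A\<close> has no member of the antichain below it, so by maximality it maps to some
  member, which is then unbalanced.\<close>
lemma unbalanced_above:
  fixes A :: "('i, nat) rel_struct"
  assumes ty: "is_type I \<delta>" and fin: "finite \<Q>" and max: "maximal_antichain I \<delta> \<Q>"
    and A: "is_struct I \<delta> A" and bal: "balanced A" and noD: "\<not> A \<leadsto> D_star I \<delta>"
    and above: "\<forall>q\<in>\<Q>. \<not> rep q \<leadsto> A"
  obtains q where "q \<in> \<Q>" "A \<leadsto> rep q" "\<not> balanced (rep q)"
proof -
  have struct: "is_struct I \<delta> (rep q)" if "q \<in> \<Q>" for q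
    using that max rep_hom_order unfolding maximal_antichain_def antichain_def by blast
  \<comment> \<open>Large enough to apply the folding argument to every member of the antichain.\<close>
  define L where "L = (\<Sum>q\<in>\<Q>. card (base (rep q))) + 2"
  have small: "card (base (rep q)) + 1 < L" if "q \<in> \<Q>" for q
    using member_le_sum[OF that _ fin, of "\<lambda>q. card (base (rep q))"] by (simp add: L_def)
  obtain i xs ys i\<^sub>0 j\<^sub>0 h where e: "xs \<in> rel A i" "ys \<in> rel A i" "(xs ! 0, ys ! 0) \<in> linked A"
    "height i\<^sub>0 j\<^sub>0 A h" "h (xs ! 0) \<noteq> h (ys ! 0)"
    by (rule balanced_not_to_D_star[OF ty A bal noD])
  let ?Z = "zigzag i xs ys L A"
  obtain Z :: "('i, nat) rel_struct" where Z: "is_struct I \<delta> Z" "?Z \<leadsto> Z" "Z \<leadsto> ?Z"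
    using nat_copy[OF zigzag_struct[OF A e(1,2)]] by blast
  have "0 < L" by (simp add: L_def)
  then have unb: "\<not> balanced ?Z" using zigzag_not_balanced[OF A ty e(1,2) _ e(3-5)] by blast
  have AZ: "A \<leadsto> ?Z" unfolding hom_to_def by (rule exI, rule zigzag_Inl)
  from maximal_antichain_comparable[OF max Z(1)]
  obtain q where q: "q \<in> \<Q>" "rep q \<leadsto> Z \<or> Z \<leadsto> rep q" by blast
  have "\<not> rep q \<leadsto> Z"
  proof
    assume "rep q \<leadsto> Z"
    then have "rep q \<leadsto> ?Z" using Z(3) by (rule hom_to_trans)
    then have "rep q \<leadsto> A" by (rule zigzag_small[OF A ty e(1,2) struct[OF q(1)] small[OF q(1)]])
    then show False using above q(1) by blast
  qed
  then have Zq: "?Z \<leadsto> rep q" using q(2) hom_to_trans[OF Z(2)] by blast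
  show ?thesis
    using that[OF q(1) hom_to_trans[OF AZ Zq]] unb balanced_pullback[OF Zq] by blast
qed

text \<open>Some selected element maps to the locally balanced cover of the witness for \<open>q\<close>, and the
  witness is above no selected element but \<open>q\<close>.\<close>
lemma greedy_balanced:
  fixes \<Q> :: "('i, nat) rel_struct set set"
  assumes ty: "is_type I \<delta>" and max: "maximal_antichain I \<delta> \<Q>"
    and qs: "set qs = \<Q>" and q: "q \<in> greedy I \<delta> {} qs"
  shows "balanced (rep q)"
proof -
  let ?\<F> = "greedy I \<delta> {} qs"
  have sub: "?\<F> \<subseteq> \<Q>" using greedy_bounds[of "{}" I \<delta> qs] qs by blast
  have struct: "is_struct I \<delta> (rep p)" if "p \<in> \<Q>" for p
    using that max rep_hom_order unfolding maximal_antichain_def antichain_def by blast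
  have anti: "p = p'" if "p \<in> \<Q>" "p' \<in> \<Q>" "rep p \<leadsto> rep p'" for p p'
    using that max unfolding maximal_antichain_def antichain_def by blast
  obtain X :: "('i, nat) rel_struct" where X: "is_struct I \<delta> X" "rep q \<prec> X"
    "\<forall>f\<in>?\<F>. f \<noteq> q \<longrightarrow> \<not> rep f \<leadsto> X"
    using greedy_witness[OF q] by blast
  have notX: "\<not> X \<leadsto> rep p" if p: "p \<in> \<Q>" for p
  proof
    assume Xp: "X \<leadsto> rep p"
    have "rep q \<leadsto> X" using X(2) by (simp add: hom_less_def)
    from hom_to_trans[OF this Xp] have "q = p" using anti q sub p by blast
    then show False using X(2) Xp by (simp add: hom_less_def)
  qed
  have "finite (\<Union>p\<in>\<Q>. base (rep p))" using struct qs by (auto simp: is_struct_def)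
  moreover have "finite I" using ty by (simp add: is_type_def)
  ultimately obtain X' :: "('i, nat) rel_struct" where X': "is_struct I \<delta> X'" "X' \<leadsto> X"
    "\<And>Q. base Q \<subseteq> (\<Union>p\<in>\<Q>. base (rep p)) \<Longrightarrow> X' \<leadsto> Q \<Longrightarrow> X \<leadsto> Q"
    "\<And>A :: ('i, nat) rel_struct.
       is_struct I \<delta> A \<Longrightarrow> card (base A) \<le> card (base (rep q)) \<Longrightarrow> A \<leadsto> X' \<Longrightarrow> balanced A"
    using locally_balanced_cover[OF _ X(1)] by metis
  have notX': "\<not> X' \<leadsto> rep p" if p: "p \<in> \<Q>" for p
    using X'(3)[of "rep p"] notX[OF p] p by blast
  obtain p where "p \<in> \<Q>" "rep p \<leadsto> X'"
    using maximal_antichain_comparable[OF max X'(1)] notX' by blast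
  then obtain f where f: "f \<in> ?\<F>" "rep f \<leadsto> X'"
    using greedy_below[OF X'(1), of qs p "{}"] notX' qs by blast
  then have "f = q" using X(3) hom_to_trans[OF f(2) X'(2)] by blast
  then show ?thesis using X'(4)[of "rep q"] f struct sub by blast
qed

lemma greedy_splitting:
  fixes I :: "'i set" and \<delta> :: "'i \<Rightarrow> nat" and \<Q> :: "('i, nat) rel_struct set set"
  assumes ty: "is_type I \<delta>" and fin: "finite \<Q>" and max: "maximal_antichain I \<delta> \<Q>"
    and dense: "\<And>q (Y::('i, nat) rel_struct). q \<in> \<Q> \<Longrightarrow> is_struct I \<delta> Y \<Longrightarrow> Y \<prec> rep q \<Longrightarrow>
      Y \<leadsto> D_star I \<delta> \<Longrightarrow>
      \<exists>X::('i, nat) rel_struct. is_struct I \<delta> X \<and> Y \<prec> X \<and> X \<prec> rep q \<and> \<not> X \<leadsto> D_star I \<delta>"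
    and qs: "set qs = \<Q>"
  shows "splitting I \<delta> \<Q> (greedy_partition I \<delta> qs)"
proof -
  let ?\<F> = "greedy I \<delta> {} qs"
  have sub: "?\<F> \<subseteq> \<Q>" using greedy_bounds[of "{}" I \<delta> qs] qs by blast
  have anti: "p = p'" if "p \<in> \<Q>" "p' \<in> \<Q>" "rep p \<leadsto> rep p'" for p p'
    using that max unfolding maximal_antichain_def antichain_def by blast
  have "(\<exists>q\<in>?\<F>. rep q \<leadsto> A) \<or> (\<exists>q\<in>\<Q> - ?\<F>. A \<leadsto> rep q)"
    if A: "is_struct I \<delta> A" for A :: "('i, nat) rel_struct"
  proof (rule ccontr)
    assume "\<not> ?thesis"
    then have noF: "\<And>q. q \<in> ?\<F> \<Longrightarrow> \<not> rep q \<leadsto> A"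
      and noD: "\<And>q. q \<in> \<Q> \<Longrightarrow> A \<leadsto> rep q \<Longrightarrow> q \<in> ?\<F>" by blast+
    obtain p where p: "p \<in> \<Q>" "rep p \<leadsto> A \<or> A \<leadsto> rep p"
      using maximal_antichain_comparable[OF max A] by blast
    have "\<exists>q\<in>\<Q>. A \<leadsto> rep q"
      using greedy_below[OF A, of qs p "{}"] p noF qs by blast
    then obtain q where q: "q \<in> \<Q>" "A \<leadsto> rep q" by blast
    have qF: "q \<in> ?\<F>" using noD q by blast
    then have "A \<prec> rep q" using q noF by (simp add: hom_less_def)
    then obtain B :: "('i, nat) rel_struct" where B: "is_struct I \<delta> B" "A \<leadsto> B" "B \<prec> rep q"
      "\<not> B \<leadsto> D_star I \<delta>"
      using dense[OF q(1) A] A hom_to_refl unfolding hom_less_def by metis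
    have Bq: "B \<leadsto> rep q" "\<not> rep q \<leadsto> B" using B(3) by (simp_all add: hom_less_def)
    have "balanced B"
      by (rule balanced_pullback[OF Bq(1) greedy_balanced[OF ty max qs qF]])
    moreover have "\<forall>p\<in>\<Q>. \<not> rep p \<leadsto> B"
    proof (intro ballI notI)
      fix p assume p: "p \<in> \<Q>" "rep p \<leadsto> B"
      then have "p = q" using anti q(1) hom_to_trans[OF p(2) Bq(1)] by blast
      then show False using p(2) Bq(2) by simp
    qed
    ultimately obtain p where p: "p \<in> \<Q>" "B \<leadsto> rep p" "\<not> balanced (rep p)"
      using unbalanced_above[OF ty fin max B(1) _ B(4)] by blast
    then have "p \<in> ?\<F>" using noD hom_to_trans[OF B(2)] by blast
    then show False using p(3) greedy_balanced[OF ty max qs] by blast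
  qed
  then show ?thesis
    using sub unfolding splitting_def greedy_partition_def by (auto simp: qs)
qed

theorem mainTheorem2:
  fixes I :: "'i set" and \<delta> :: "'i \<Rightarrow> nat" and \<Q> :: "('i, nat) rel_struct set set"
  assumes "is_type I \<delta>"
    and "finite \<Q>"
    and "maximal_antichain I \<delta> \<Q>"
    and "\<And>q (Y::('i, nat) rel_struct). q \<in> \<Q> \<Longrightarrow> is_struct I \<delta> Y \<Longrightarrow> Y \<prec> rep q \<Longrightarrow> Y \<leadsto> D_star I \<delta> \<Longrightarrow>
           \<exists>X::('i, nat) rel_struct. is_struct I \<delta> X \<and> Y \<prec> X \<and> X \<prec> rep q \<and> \<not> X \<leadsto> D_star I \<delta>"
  shows "splits I \<delta> \<Q> \<and>
         (\<forall>qs. distinct qs \<and> set qs = \<Q> \<longrightarrow> splitting I \<delta> \<Q> (greedy_partition I \<delta> qs))"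
proof -
  have *: "splitting I \<delta> \<Q> (greedy_partition I \<delta> qs)" if "set qs = \<Q>" for qs
    using assms that by (rule greedy_splitting)
  obtain qs where "set qs = \<Q>" using finite_list[OF assms(2)] by blast
  from *[OF this] have "splits I \<delta> \<Q>"
    unfolding splits_def greedy_partition_def by blast
  with * show ?thesis by blast
qed

end
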